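(* Let $G=(V,E,m)$ be a finite graph embedded on the flat torus $\mathbb{R}^2/L$ (a graph with gains $m$ in $\mathbb{Z}^2$), and suppose that $G$ is isostatic on the torus. Then the following are equivalent: (a) $G$ has no proper subgraph that is isostatic on the torus. (b) For every orientation of the edges of $G$ in which all vertices but one have in-degree $2$, the directed subgraph induced on all vertices other than that one exceptional vertex is strongly connected. (c) For every edge $b\in E$, and for generic positions $X$, the frame $(G-b,X)$ has a zero mode $u$ that moves all vertices relative to each other, i.e. $u_i\neq u_j$ for all distinct $i,j\in V$. (d) A generic torque on any edge stresses all bonds: for every edge $b\in E$ with endpoints $i,j$, for generic positions $X$ and generic $f\in\mathbb{R}^2$, the unique set of bond tensions $t\in\mathbb{R}^{E}$ of $(G,X)$ that balances the external load consisting of the force $f$ applied at $i$, the force $-f$ applied at $j$, and zero force at all other vertices, satisfies $t_c\neq 0$ for every edge $c\in E$. (e) For every new edge $e$ joining two distinct vertices of $V$ with an arbitrary gain in $\mathbb{Z}^2$, and for generic positions $X$, the state of self stress of $(G+e,X)$ introduced by adding $e$ (unique up to scaling) either is nonzero on all edges of $G+e$, or is nonzero only on the edges of a non-constructive subgraph of $G+e$.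
   Context: Graphs on the torus. Fix linearly independent $L_1,L_2\in\mathbb{R}^2$ and let $L=\mathbb{Z}L_1+\mathbb{Z}L_2$; the torus $\mathbb{R}^2/L$ is fixed (periodic boundary conditions with a fixed box). A graph embedded on the torus is a finite loopless multigraph $(V,E)$ (parallel edges allowed) together with a gain $m_b=(m_b^1,m_b^2)\in\mathbb{Z}^2$ for each edge $b\in E$, given with respect to a fixed reference ordering $(i,j)$ of its endpoints (reversing the ordering changes the sign of $m_b$). The gain records how the edge wraps around the torus. This reference ordering is unrelated to the orientations in (b). Subgraphs inherit the gains; $G-b$ and $G+e$ denote deletion and addition of an edge, keeping the vertex set. Constructive. The net gain of a cycle is the sum of the gains of its edges, with signs according to the direction of traversal. A subgraph is embedded constructively (is constructive) if it contains a cycle with nonzero net gain, i.e. it wraps around the torus; otherwise it is non-constructive. Frames. A frame $(G,X)$ consists of positions $X=(x_i)_{i\in V}\in(\mathbb{R}^2)^V$. The edge $b$ with reference ordering $(i,j)$ has edge vector $d_b=x_j+m_b^1L_1+m_b^2L_2-x_i$. The compatibility matrix $C=C(G,X)$ maps displacements $u\in(\mathbb{R}^2)^V$ to $(Cu)_b=d_b\cdot(u_j-u_i)$ (edges may equivalently be normalized by length). A zero mode (ZM) is an element of $\ker C$; the trivial ZMs are the translations ($u_i$ independent of $i$). The equilibrium matrix is $Q=C^T$. A state of self stress (SSS) is an element $t\in\ker Q$, with $t_b$ the tension of edge $b$; an edge is stressed if $t_b\ne0$. Tensions $t$ balance an external load $F\in(\mathbb{R}^2)^V$ if $F=Qt$.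 Generic. A property holds for generic positions $X$ (or generic $(X,f)$) if it holds for all values outside some proper real algebraic subset. Isostatic. $G$ is rigid on the torus if for generic $X$ the only ZMs of $(G,X)$ are translations. $G$ is isostatic on the torus if it is rigid on the torus and the deletion of any edge produces a nontrivial ZM for generic $X$; equivalently, for generic $X$ the only ZMs are translations and there is no nonzero SSS. Isostatic subgraphs are required to have at least one edge (single vertices are not counted). The empty digraph is regarded as strongly connected. *)

theory Defs
  imports "HOL-Analysis.Analysis" "Graph_Theory.Digraph_Component" "Graph_Theory.Arc_Walk"
begin

section \<open>Generic points\<close>

text \<open>
  Properties are considered at the points of a coordinate subspace \<open>W\<close> of a Euclidean space.
  Its real algebraic subsets are the common zero sets in \<open>W\<close> of finitely many polynomials;
  a polynomial on \<open>W\<close> is the restriction of a polynomial on the ambient space.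
\<close>

definition algebraic_subset :: "'a::euclidean_space set \<Rightarrow> 'a set \<Rightarrow> bool" where
  "algebraic_subset W S \<longleftrightarrow>
     (\<exists>P. finite P \<and> (\<forall>p\<in>P. real_polynomial_function p) \<and> S = {x \<in> W. \<forall>p\<in>P. p x = 0})"

definition generically :: "'a::euclidean_space set \<Rightarrow> ('a \<Rightarrow> bool) \<Rightarrow> bool" where
  "generically W Q \<longleftrightarrow> (\<exists>S. algebraic_subset W S \<and> S \<noteq> W \<and> (\<forall>x \<in> W - S. Q x))"


section \<open>Graphs on the torus\<close>

text \<open>
  A graph on the torus is a finite loop-free \<^typ>\<open>('v, 'e) pre_digraph\<close> \<open>G\<close> together with a gain
  map \<open>m :: 'e \<Rightarrow> int \<times> int\<close>. The pair (tail, head) of an arc is only the reference ordering of the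
  endpoints of that edge; the graph itself is thought of as undirected. A subgraph of \<open>G\<close> is used
  with the same gain map.
\<close>

type_synonym gain = "int \<times> int"

definition add_edge :: "('v, 'e) pre_digraph \<Rightarrow> 'v \<Rightarrow> 'v \<Rightarrow> ('v, 'e option) pre_digraph" where
  "add_edge G i j = \<lparr> verts = verts G, arcs = insert None (Some ` arcs G),
     tail = case_option i (tail G), head = case_option j (head G) \<rparr>"

definition add_gain :: "('e \<Rightarrow> gain) \<Rightarrow> gain \<Rightarrow> 'e option \<Rightarrow> gain" where
  "add_gain m k = case_option k m"

text \<open>
  An arc \<open>(b, True)\<close> of the bidirected graph is the edge \<open>b\<close> traversed along its reference ordering,
  \<open>(b, False)\<close> is the same edge traversed backwards. An edge occurs only once in a cycle, but two
  parallel edges form a cycle.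
\<close>

definition bidirected :: "('v, 'e) pre_digraph \<Rightarrow> ('v, 'e \<times> bool) pre_digraph" where
  "bidirected G = \<lparr> verts = verts G, arcs = arcs G \<times> UNIV,
     tail = (\<lambda>(b, d). if d then tail G b else head G b),
     head = (\<lambda>(b, d). if d then head G b else tail G b) \<rparr>"

definition undirected_cycle :: "('v, 'e) pre_digraph \<Rightarrow> ('e \<times> bool) list \<Rightarrow> bool" where
  "undirected_cycle G p \<longleftrightarrow> pre_digraph.cycle (bidirected G) p \<and> distinct (map fst p)"

definition net_gain :: "('e \<Rightarrow> gain) \<Rightarrow> ('e \<times> bool) list \<Rightarrow> gain" where
  "net_gain m p = (\<Sum>(b, d)\<leftarrow>p. if d then m b else - m b)"

definition constructive :: "('e \<Rightarrow> gain) \<Rightarrow> ('v, 'e) pre_digraph \<Rightarrow> bool" where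
  "constructive m G \<longleftrightarrow> (\<exists>p. undirected_cycle G p \<and> net_gain m p \<noteq> 0)"

text \<open>
  The orientation \<open>\<rho>\<close> keeps the reference ordering of the edges with \<open>\<rho> b\<close> and reverses the others.
\<close>

definition orient :: "('v, 'e) pre_digraph \<Rightarrow> ('e \<Rightarrow> bool) \<Rightarrow> ('v, 'e) pre_digraph" where
  "orient G \<rho> = \<lparr> verts = verts G, arcs = arcs G,
     tail = (\<lambda>b. if \<rho> b then tail G b else head G b),
     head = (\<lambda>b. if \<rho> b then head G b else tail G b) \<rparr>"


section \<open>Frames\<close>

text \<open>
  \<open>configs V\<close> is \<open>(\<real>\<^sup>2)\<^sup>V\<close>, and \<open>tensions E\<close> is \<open>\<real>\<^sup>E\<close>; in both cases the components outside the index
  set, which carry no information, are fixed to be zero.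
\<close>

definition configs :: "'v::finite set \<Rightarrow> (real^2^'v) set" where
  "configs V = {X. \<forall>i. i \<notin> V \<longrightarrow> X $ i = 0}"

definition tensions :: "'e set \<Rightarrow> ('e \<Rightarrow> real) set" where
  "tensions E = {t. \<forall>b. b \<notin> E \<longrightarrow> t b = 0}"

definition edge_vec ::
  "real^2 \<Rightarrow> real^2 \<Rightarrow> ('e \<Rightarrow> gain) \<Rightarrow> ('v::finite, 'e) pre_digraph \<Rightarrow> real^2^'v \<Rightarrow> 'e \<Rightarrow> real^2" where
  "edge_vec L1 L2 m G X b =
     X $ head G b + of_int (fst (m b)) *\<^sub>R L1 + of_int (snd (m b)) *\<^sub>R L2 - X $ tail G b"

definition compat ::
  "real^2 \<Rightarrow> real^2 \<Rightarrow> ('e \<Rightarrow> gain) \<Rightarrow> ('v::finite, 'e) pre_digraph \<Rightarrow> real^2^'v \<Rightarrow> real^2^'v \<Rightarrow> 'e \<Rightarrow> real"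
  where
  "compat L1 L2 m G X u b = edge_vec L1 L2 m G X b \<bullet> (u $ head G b - u $ tail G b)"

definition equilibrium ::
  "real^2 \<Rightarrow> real^2 \<Rightarrow> ('e \<Rightarrow> gain) \<Rightarrow> ('v::finite, 'e) pre_digraph \<Rightarrow> real^2^'v \<Rightarrow> ('e \<Rightarrow> real) \<Rightarrow> real^2^'v"
  where
  "equilibrium L1 L2 m G X t =
     (\<chi> i. (\<Sum>b\<in>in_arcs G i. t b *\<^sub>R edge_vec L1 L2 m G X b)
         - (\<Sum>b\<in>out_arcs G i. t b *\<^sub>R edge_vec L1 L2 m G X b))"

text \<open>\<open>equilibrium\<close> is the transpose of \<open>compat\<close>.\<close>

lemma equilibrium_adjoint_compat:
  fixes G :: "('v::finite, 'e) pre_digraph"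
  assumes "finite (arcs G)"
  shows "equilibrium L1 L2 m G X t \<bullet> u = (\<Sum>b\<in>arcs G. t b * compat L1 L2 m G X u b)"
proof -
  let ?d = "\<lambda>b. edge_vec L1 L2 m G X b"
  have inc: "(\<Sum>i\<in>UNIV. \<Sum>b\<in>{b \<in> arcs G. h b = i}. t b * (?d b \<bullet> u $ i))
      = (\<Sum>b\<in>arcs G. t b * (?d b \<bullet> u $ h b))" for h :: "'e \<Rightarrow> 'v"
  proof -
    have "(\<Sum>i\<in>UNIV. \<Sum>b\<in>{b \<in> arcs G. h b = i}. t b * (?d b \<bullet> u $ i))
        = (\<Sum>i\<in>UNIV. \<Sum>b\<in>{b \<in> arcs G. h b = i}. t b * (?d b \<bullet> u $ h b))"
      by (intro sum.cong) auto
    also have "\<dots> = (\<Sum>b\<in>arcs G. t b * (?d b \<bullet> u $ h b))"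
      by (rule sum.group) (use assms in auto)
    finally show ?thesis .
  qed
  show ?thesis
    using inc[of "head G"] inc[of "tail G"]
    by (simp add: equilibrium_def compat_def in_arcs_def out_arcs_def inner_vec_def[of _ u]
        inner_diff_left inner_diff_right inner_sum_left sum_subtractf right_diff_distrib)
qed

definition zero_modes ::
  "real^2 \<Rightarrow> real^2 \<Rightarrow> ('e \<Rightarrow> gain) \<Rightarrow> ('v::finite, 'e) pre_digraph \<Rightarrow> real^2^'v \<Rightarrow> (real^2^'v) set" where
  "zero_modes L1 L2 m G X = {u \<in> configs (verts G). \<forall>b\<in>arcs G. compat L1 L2 m G X u b = 0}"

definition trivial_zero_modes :: "('v::finite, 'e) pre_digraph \<Rightarrow> (real^2^'v) set" where
  "trivial_zero_modes G = {u \<in> configs (verts G). \<forall>i\<in>verts G. \<forall>j\<in>verts G. u $ i = u $ j}"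

definition self_stresses ::
  "real^2 \<Rightarrow> real^2 \<Rightarrow> ('e \<Rightarrow> gain) \<Rightarrow> ('v::finite, 'e) pre_digraph \<Rightarrow> real^2^'v \<Rightarrow> ('e \<Rightarrow> real) set" where
  "self_stresses L1 L2 m G X = {t \<in> tensions (arcs G). equilibrium L1 L2 m G X t = 0}"

definition balances ::
  "real^2 \<Rightarrow> real^2 \<Rightarrow> ('e \<Rightarrow> gain) \<Rightarrow> ('v::finite, 'e) pre_digraph \<Rightarrow> real^2^'v \<Rightarrow> ('e \<Rightarrow> real) \<Rightarrow>
   real^2^'v \<Rightarrow> bool" where
  "balances L1 L2 m G X t F \<longleftrightarrow> t \<in> tensions (arcs G) \<and> F = equilibrium L1 L2 m G X t"

definition force_pair :: "'v::finite \<Rightarrow> 'v \<Rightarrow> real^2 \<Rightarrow> real^2^'v" where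
  "force_pair i j f = (\<chi> k. if k = i then f else if k = j then - f else 0)"


section \<open>Isostatic graphs\<close>

definition rigid ::
  "real^2 \<Rightarrow> real^2 \<Rightarrow> ('e \<Rightarrow> gain) \<Rightarrow> ('v::finite, 'e) pre_digraph \<Rightarrow> bool" where
  "rigid L1 L2 m G \<longleftrightarrow>
     generically (configs (verts G)) (\<lambda>X. zero_modes L1 L2 m G X \<subseteq> trivial_zero_modes G)"

definition isostatic ::
  "real^2 \<Rightarrow> real^2 \<Rightarrow> ('e \<Rightarrow> gain) \<Rightarrow> ('v::finite, 'e) pre_digraph \<Rightarrow> bool" where
  "isostatic L1 L2 m G \<longleftrightarrow> rigid L1 L2 m G \<and>
     (\<forall>b\<in>arcs G. generically (configs (verts G))
        (\<lambda>X. \<exists>u \<in> zero_modes L1 L2 m (pre_digraph.del_arc G b) X. u \<notin> trivial_zero_modes G))"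


section \<open>The five conditions\<close>

definition no_proper_isostatic_subgraph ::
  "real^2 \<Rightarrow> real^2 \<Rightarrow> ('e \<Rightarrow> gain) \<Rightarrow> ('v::finite, 'e) pre_digraph \<Rightarrow> bool" where
  "no_proper_isostatic_subgraph L1 L2 m G \<longleftrightarrow>
     \<not> (\<exists>H. subgraph H G \<and> H \<noteq> G \<and> arcs H \<noteq> {} \<and> isostatic L1 L2 m H)"

text \<open>
  \<^const>\<open>strongly_connected\<close> excludes the graph without vertices, which here counts as strongly
  connected.
\<close>

definition orientations_strongly_connected :: "('v, 'e) pre_digraph \<Rightarrow> bool" where
  "orientations_strongly_connected G \<longleftrightarrow>
     (\<forall>\<rho>. \<forall>w\<in>verts G. {v \<in> verts G. in_degree (orient G \<rho>) v \<noteq> 2} = {w} \<longrightarrow>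
        (let H = orient G \<rho> \<restriction> (verts G - {w}) in verts H = {} \<or> strongly_connected H))"

definition deletion_moves_all ::
  "real^2 \<Rightarrow> real^2 \<Rightarrow> ('e \<Rightarrow> gain) \<Rightarrow> ('v::finite, 'e) pre_digraph \<Rightarrow> bool" where
  "deletion_moves_all L1 L2 m G \<longleftrightarrow>
     (\<forall>b\<in>arcs G. generically (configs (verts G))
        (\<lambda>X. \<exists>u \<in> zero_modes L1 L2 m (pre_digraph.del_arc G b) X.
              \<forall>i\<in>verts G. \<forall>j\<in>verts G. i \<noteq> j \<longrightarrow> u $ i \<noteq> u $ j))"

definition torque_stresses_all ::
  "real^2 \<Rightarrow> real^2 \<Rightarrow> ('e \<Rightarrow> gain) \<Rightarrow> ('v::finite, 'e) pre_digraph \<Rightarrow> bool" where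
  "torque_stresses_all L1 L2 m G \<longleftrightarrow>
     (\<forall>b\<in>arcs G. generically (configs (verts G) \<times> (UNIV :: (real^2) set))
        (\<lambda>(X, f). \<exists>t. {t'. balances L1 L2 m G X t' (force_pair (tail G b) (head G b) f)} = {t} \<and>
                      (\<forall>c\<in>arcs G. t c \<noteq> 0)))"

definition added_edge_stress ::
  "real^2 \<Rightarrow> real^2 \<Rightarrow> ('e \<Rightarrow> gain) \<Rightarrow> ('v::finite, 'e) pre_digraph \<Rightarrow> bool" where
  "added_edge_stress L1 L2 m G \<longleftrightarrow>
     (\<forall>i\<in>verts G. \<forall>j\<in>verts G. \<forall>k. i \<noteq> j \<longrightarrow>
        (let G' = add_edge G i j; m' = add_gain m k in
          generically (configs (verts G))
            (\<lambda>X. \<exists>s. s \<noteq> (\<lambda>_. 0) \<and>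
                   self_stresses L1 L2 m' G' X = range (\<lambda>a c. a * s c) \<and>
                   ((\<forall>c\<in>arcs G'. s c \<noteq> 0) \<or>
                    (\<exists>H. subgraph H G' \<and> \<not> constructive m' H \<and>
                         (\<forall>c\<in>arcs G'. s c \<noteq> 0 \<longrightarrow> c \<in> arcs H))))))"

end

theory Submission
  imports Defs
begin

text \<open>
  At an infinitesimally rigid configuration of an isostatic graph the tensions balancing a load are
  unique and, by Cramer's rule, rational in the configuration. All subgraphs have independent rows, so
  that a subgraph with vertex set \<open>V'\<close> is isostatic iff it has \<open>2 |V'| - 2\<close> edges; together with a
  nonvanishing term of the Laplace expansion, which provides orientations, this gives the
  equivalence of (a) and (b).

  For the remaining ones no combinatorial characterization of rigidity is needed. Let \<open>t\<close> be a self
  stress depending on a generic configuration, and \<open>u\<close> a motion of its support, so that in the plane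
  \<open>u\<close> rotates each stressed edge \<open>c\<close> at some rate \<open>\<lambda>\<^sub>c\<close>. Differentiating \<open>t \<bullet> C u = 0\<close> in the
  configuration shows that \<open>\<lambda>\<^sub>c t\<^sub>c\<close> is a self stress too. If self stresses are unique up to scaling, all
  rates agree. The common rate vanishes if the support contains a cycle with nonzero net gain, or if the
  support resists all forces between two of its vertices; in these cases the support is rigid, and
  hence an isostatic subgraph.
\<close>

section \<open>Generic points\<close>

text \<open>The obstacle is that a stress and its support vary with the configuration, whereas
  differentiation compares nearby configurations. Supports are therefore defined by existence: an
  edge belongs to the support if it is stressed at some rigid configuration. Outside this fixed set
  the tension vanishes at every rigid configuration, inside it generically not. The derivative of
  \<open>t\<close> then contributes nothing: off the support it is zero, on the support it meets a
  zero strain. What remains is linear in the direction in which the configuration is moved, and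
  moving it along the quarter turn of a load converts the rotations of the edges back into strains
  of that load.

  The two ways to make the rate vanish belong to different conditions. For (c) and (d) the force
  between two vertices is free; it becomes the tension of a fictitious edge with a real gain vector
  \<open>g\<close>, so that the same argument covers both cases. For (e) the force is tied to the
  direction of the new edge, and a non-constructive support, unrolled into the plane, can indeed
  rotate as a whole. This is the origin of the exception in (e).\<close>

lemma real_polynomial_line:
  fixes p :: "'a::real_normed_vector \<Rightarrow> real"
  assumes p: "real_polynomial_function p" and nz: "p (x + c *\<^sub>R v) \<noteq> 0"
  shows "finite {e. p (x + e *\<^sub>R v) = 0}"
proof -
  have "polynomial_function (\<lambda>e::real. x + e *\<^sub>R v)"
    by (intro polynomial_function_add polynomial_function_bounded_linear polynomial_function_const
        bounded_linear_scaleR_left)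
  from real_polynomial_function_compose[OF this p]
  obtain a n where an: "p \<circ> (\<lambda>e. x + e *\<^sub>R v) = (\<lambda>e. \<Sum>i\<le>n. a i * e ^ i)"
    unfolding real_polynomial_function_iff_sum by auto
  then have eq: "p (x + e *\<^sub>R v) = (\<Sum>i\<le>n. a i * e ^ i)" for e
    by (auto simp: fun_eq_iff)
  have "\<exists>k\<le>n. a k \<noteq> 0"
  proof (rule ccontr)
    assume "\<not> ?thesis"
    then have "p (x + c *\<^sub>R v) = 0"
      by (simp add: eq)
    with nz show False by simp
  qed
  then show ?thesis
    using polyfun_roots_finite[of a _ n] by (auto simp: eq)
qed

text \<open>If \<open>S\<close> misses a point of \<open>W\<close>, some polynomial of its finite
  family is nonzero there, and the zero set of that one polynomial contains \<open>S\<close>. So a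
  single polynomial witnesses genericity.\<close>

lemma generically_iff:
  "generically W Q \<longleftrightarrow>
    (\<exists>p. real_polynomial_function p \<and> (\<exists>x\<in>W. p x \<noteq> 0) \<and> (\<forall>x\<in>W. p x \<noteq> 0 \<longrightarrow> Q x))"
proof
  assume "generically W Q"
  then obtain P where P: "\<forall>p\<in>P. real_polynomial_function p"
      "{x \<in> W. \<forall>p\<in>P. p x = 0} \<noteq> W" "\<forall>x\<in>W - {x \<in> W. \<forall>p\<in>P. p x = 0}. Q x"
    unfolding generically_def algebraic_subset_def by blast
  then obtain p x where "p \<in> P" "x \<in> W" "p x \<noteq> 0" by blast
  with P show "\<exists>p. real_polynomial_function p \<and> (\<exists>x\<in>W. p x \<noteq> 0) \<and> (\<forall>x\<in>W. p x \<noteq> 0 \<longrightarrow> Q x)"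
    by blast
next
  assume "\<exists>p. real_polynomial_function p \<and> (\<exists>x\<in>W. p x \<noteq> 0) \<and> (\<forall>x\<in>W. p x \<noteq> 0 \<longrightarrow> Q x)"
  then obtain p where p: "real_polynomial_function p" "\<exists>x\<in>W. p x \<noteq> 0" "\<forall>x\<in>W. p x \<noteq> 0 \<longrightarrow> Q x"
    by blast
  show "generically W Q"
    unfolding generically_def algebraic_subset_def
    by (rule exI[of _ "{x\<in>W. p x = 0}"]) (use p in \<open>auto intro!: exI[of _ "{p}"]\<close>)
qed

lemma generically_nonzero:
  assumes "real_polynomial_function p" "x \<in> W" "p x \<noteq> 0"
  shows "generically W (\<lambda>x. p x \<noteq> 0)"
  using assms unfolding generically_iff by blast

lemma generically_mono:
  assumes "generically W P" "\<And>x. x \<in> W \<Longrightarrow> P x \<Longrightarrow> Q x"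
  shows "generically W Q"
  using assms unfolding generically_iff by meson

lemma generically_ex:
  assumes "generically W P"
  shows "\<exists>x\<in>W. P x"
  using assms unfolding generically_iff by blast

lemma generically_conj:
  assumes W: "subspace W" and P: "generically W P" and Q: "generically W Q"
  shows "generically W (\<lambda>x. P x \<and> Q x)"
proof -
  obtain p x where p: "real_polynomial_function p" "x \<in> W" "p x \<noteq> 0" "\<forall>x\<in>W. p x \<noteq> 0 \<longrightarrow> P x"
    using P unfolding generically_iff by blast
  obtain q y where q: "real_polynomial_function q" "y \<in> W" "q y \<noteq> 0" "\<forall>x\<in>W. q x \<noteq> 0 \<longrightarrow> Q x"
    using Q unfolding generically_iff by blast
  \<comment> \<open>On the line from a nonzero of \<open>p\<close> to a nonzero of \<open>q\<close>
    each has finitely many zeros, so \<open>p * q\<close> is nonzero somewhere on it; a subspace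
    contains this line.\<close>
  have "finite {e. p (x + e *\<^sub>R (y - x)) = 0}" "finite {e. q (x + e *\<^sub>R (y - x)) = 0}"
    using p q by (auto intro: real_polynomial_line[where c = 0] real_polynomial_line[where c = 1])
  then have "finite ({e. p (x + e *\<^sub>R (y - x)) = 0} \<union> {e. q (x + e *\<^sub>R (y - x)) = 0})"
    by simp
  then obtain e where e: "e \<notin> {e. p (x + e *\<^sub>R (y - x)) = 0} \<union> {e. q (x + e *\<^sub>R (y - x)) = 0}"
    using ex_new_if_finite[OF infinite_UNIV_char_0] by blast
  have "x + e *\<^sub>R (y - x) \<in> W"
    using W p q by (simp add: subspace_add subspace_diff subspace_scale)
  then show ?thesis
    unfolding generically_iff
    by (intro exI[of _ "\<lambda>x. p x * q x"]) (use p q e in auto)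
qed

lemma generically_ball:
  assumes "subspace W" "finite C" "W \<noteq> {}" "\<And>c. c \<in> C \<Longrightarrow> generically W (P c)"
  shows "generically W (\<lambda>x. \<forall>c\<in>C. P c x)"
  using assms(2,4)
proof (induction rule: finite_induct)
  case empty
  show ?case
    unfolding generically_iff using \<open>W \<noteq> {}\<close> by (auto intro!: exI[of _ "\<lambda>_. 1"])
next
  case (insert c C)
  then show ?case
    using generically_conj[OF assms(1), of "P c" "\<lambda>x. \<forall>c\<in>C. P c x"] by simp
qed

text \<open>Surjectivity onto \<open>W\<close> keeps the pulled-back polynomial from vanishing on
  all of \<open>V\<close>.\<close>

lemma generically_compose:
  fixes h :: "'a::euclidean_space \<Rightarrow> 'b::euclidean_space"
  assumes "generically W P" "polynomial_function h"
    and "\<And>x. x \<in> V \<Longrightarrow> h x \<in> W" "\<And>y. y \<in> W \<Longrightarrow> \<exists>x\<in>V. h x = y"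
  shows "generically V (\<lambda>x. P (h x))"
proof -
  obtain p y where p: "real_polynomial_function p" "y \<in> W" "p y \<noteq> 0" "\<forall>x\<in>W. p x \<noteq> 0 \<longrightarrow> P x"
    using assms(1) unfolding generically_iff by blast
  have "real_polynomial_function (\<lambda>x. p (h x))"
    using real_polynomial_function_compose[OF assms(2) p(1)] by (simp add: o_def)
  then show ?thesis
    unfolding generically_iff using p assms by metis
qed

section \<open>Polynomials in vector coordinates and Cramer's rule\<close>

lemma polynomial_function_vec_nth [intro]:
  "polynomial_function f \<Longrightarrow> polynomial_function (\<lambda>x. f x $ i)"
  using polynomial_function_compose[of f "\<lambda>y. y $ i"]
  by (simp add: o_def polynomial_function_bounded_linear bounded_linear_vec_nth)

lemma real_polynomial_function_vec_nth [intro]: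
  fixes f :: "'a::real_normed_vector \<Rightarrow> real^'n"
  shows "polynomial_function f \<Longrightarrow> real_polynomial_function (\<lambda>x. f x $ i)"
  using polynomial_function_vec_nth[of f i] by (simp add: real_polynomial_function_eq)

lemma polynomial_function_vec:
  fixes f :: "'a::euclidean_space \<Rightarrow> 'b::euclidean_space^'n"
  shows "polynomial_function f \<longleftrightarrow> (\<forall>i. polynomial_function (\<lambda>x. f x $ i))"
proof
  assume *: "\<forall>i. polynomial_function (\<lambda>x. f x $ i)"
  show "polynomial_function f"
    unfolding polynomial_function_iff_Basis_inner
  proof
    fix b :: "'b^'n" assume "b \<in> Basis"
    then obtain i c where b: "b = axis i c" "c \<in> Basis"
      by (auto simp: Basis_vec_def)
    then show "real_polynomial_function (\<lambda>x. f x \<bullet> b)"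
      using * unfolding polynomial_function_iff_Basis_inner by (auto simp: inner_axis)
  qed
qed auto

lemma polynomial_function_vec2:
  fixes f :: "'a::euclidean_space \<Rightarrow> real^2^'n"
  shows "polynomial_function f \<longleftrightarrow> (\<forall>i k. real_polynomial_function (\<lambda>x. f x $ i $ k))"
  by (simp add: polynomial_function_vec real_polynomial_function_eq)

text \<open>The vectors are flattened because determinants are only defined on \<open>real^'n^'n\<close>.\<close>

definition flat_matrix :: "(real^2^'v::finite \<Rightarrow> real^2^'v) \<Rightarrow> real^('v\<times>2)^('v\<times>2)" where
  "flat_matrix A = (\<chi> p q. A (axis (fst q) (axis (snd q) 1)) $ fst p $ snd p)"

definition flat :: "real^2^'v::finite \<Rightarrow> real^('v\<times>2)" where
  "flat u = (\<chi> p. u $ fst p $ snd p)"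

lemma flat_eq_iff [simp]: "flat u = flat v \<longleftrightarrow> u = v"
  by (auto simp: flat_def vec_eq_iff)

lemma flat_surj: "\<exists>u. flat u = w"
  by (rule exI[of _ "\<chi> i k. w $ (i, k)"]) (simp add: flat_def vec_eq_iff)

lemma flat_0 [simp]: "flat 0 = 0"
  by (simp add: flat_def vec_eq_iff)

lemma flat_matrix_mult:
  fixes A :: "real^2^'v::finite \<Rightarrow> real^2^'v"
  assumes "linear A"
  shows "flat_matrix A *v flat u = flat (A u)"
proof -
  have "axis (fst q) (axis (snd q) (1::real)) $ i $ k = (if q = (i, k) then 1 else 0)"
    for q :: "'v \<times> 2" and i k
    by (cases q) (auto simp: axis_def)
  then have u: "u = (\<Sum>q\<in>UNIV. (u $ fst q $ snd q) *\<^sub>R axis (fst q) (axis (snd q) 1))"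
    by (simp add: vec_eq_iff if_distrib[of "(*) _"] sum.delta' cong: if_cong)
  have "A u = (\<Sum>q\<in>UNIV. (u $ fst q $ snd q) *\<^sub>R A (axis (fst q) (axis (snd q) 1)))"
    by (subst u) (simp only: linear_sum[OF assms] linear_scale[OF assms])
  then show ?thesis
    by (simp add: flat_def vec_eq_iff matrix_vector_mult_def flat_matrix_def mult.commute)
qed

lemma det_flat_matrix_nonzero:
  fixes A :: "real^2^'v::finite \<Rightarrow> real^2^'v"
  assumes A: "linear A"
  shows "det (flat_matrix A) \<noteq> 0 \<longleftrightarrow> (\<forall>u. A u = 0 \<longrightarrow> u = 0)"
proof -
  have "det (flat_matrix A) \<noteq> 0 \<longleftrightarrow> (\<forall>w. flat_matrix A *v w = 0 \<longrightarrow> w = 0)"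
    by (simp add: invertible_det_nz[symmetric] invertible_left_inverse matrix_left_invertible_ker)
  also have "\<dots> \<longleftrightarrow> (\<forall>u. A u = 0 \<longrightarrow> u = 0)"
    by (metis A flat_0 flat_eq_iff flat_matrix_mult flat_surj)
  finally show ?thesis .
qed

lemma polynomial_det:
  fixes M :: "'a::real_normed_vector \<Rightarrow> real^'n^'n"
  assumes "\<And>i j. real_polynomial_function (\<lambda>x. M x $ i $ j)"
  shows "real_polynomial_function (\<lambda>x. det (M x))"
  unfolding det_def
  by (intro real_polynomial_function_sum real_polynomial_function.intros(2,4)
      real_polynomial_function_prod assms) (auto simp: finite_permutations)

text \<open>Cramer's rule without division: the numerators are determinants with one column
  replaced, hence polynomials in the parameter. It speaks of any solution \<open>u\<close>, so it
  also applies to a chosen one.\<close>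

lemma polynomial_cramer:
  fixes A :: "'p::real_normed_vector \<Rightarrow> real^2^'v::finite \<Rightarrow> real^2^'v"
  assumes A: "\<And>x. linear (A x)" "\<And>u i k. real_polynomial_function (\<lambda>x. A x u $ i $ k)"
    and b: "\<And>i k. real_polynomial_function (\<lambda>x. b x $ i $ k)"
  obtains N where "\<And>i k. real_polynomial_function (N i k)"
    and "\<And>x u i k. \<lbrakk>det (flat_matrix (A x)) \<noteq> 0; A x u = b x\<rbrakk> \<Longrightarrow>
           u $ i $ k * det (flat_matrix (A x)) = N i k x"
proof
  define N where "N i k x = det (\<chi> p q. if q = (i, k) then flat (b x) $ p else flat_matrix (A x) $ p $ q)"
    for i k x
  show "real_polynomial_function (N i k)" for i k
    unfolding N_def
  proof (rule polynomial_det, goal_cases)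
    case (1 p q)
    show ?case
      by (cases "q = (i, k)") (simp_all add: flat_def flat_matrix_def A b)
  qed
  fix x u i k
  assume nz: "det (flat_matrix (A x)) \<noteq> 0" and "A x u = b x"
  then have "flat_matrix (A x) *v flat u = flat (b x)"
    by (simp add: flat_matrix_mult A)
  then have "flat u $ (i, k) = N i k x / det (flat_matrix (A x))"
    using cramer[OF nz, of "flat u" "flat (b x)"] by (simp add: N_def)
  then show "u $ i $ k * det (flat_matrix (A x)) = N i k x"
    using nz by (simp add: flat_def)
qed


section \<open>Finite families of vectors\<close>

text \<open>A family and not a set, because parallel edges can have equal rows, which a set would
  merge into one vector.\<close>

definition indep_family :: "'b set \<Rightarrow> ('b \<Rightarrow> 'a::real_vector) \<Rightarrow> bool" where
  "indep_family I r \<longleftrightarrow> (\<forall>t. (\<Sum>b\<in>I. t b *\<^sub>R r b) = 0 \<longrightarrow> (\<forall>b\<in>I. t b = 0))"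

lemma indep_familyD:
  "\<lbrakk>indep_family I r; (\<Sum>b\<in>I. t b *\<^sub>R r b) = 0; b \<in> I\<rbrakk> \<Longrightarrow> t b = 0"
  unfolding indep_family_def by blast

lemma indep_family_mono:
  assumes "indep_family I r" "J \<subseteq> I" "finite I"
  shows "indep_family J r"
  unfolding indep_family_def
proof (intro allI impI)
  fix t assume "(\<Sum>b\<in>J. t b *\<^sub>R r b) = 0"
  then have "(\<Sum>b\<in>I. (if b \<in> J then t b else 0) *\<^sub>R r b) = 0"
    using assms by (subst sum.mono_neutral_cong_right[of I J _ "\<lambda>b. t b *\<^sub>R r b"]) auto
  from indep_familyD[OF assms(1) this] show "\<forall>b\<in>J. t b = 0"
    using assms(2) by (metis subsetD)
qed

lemma indep_family_iff:
  assumes "finite I"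
  shows "indep_family I r \<longleftrightarrow> inj_on r I \<and> independent (r ` I)"
proof
  assume *: "indep_family I r"
  have inj: "inj_on r I"
  proof
    fix b c assume bc: "b \<in> I" "c \<in> I" "r b = r c"
    show "b = c"
    proof (rule ccontr)
      assume "b \<noteq> c"
      then have "(\<Sum>a\<in>{b, c}. (if a = b then 1 else -1) *\<^sub>R r a) = 0"
        using bc(3) by simp
      moreover have "indep_family {b, c} r"
        using indep_family_mono[OF *, of "{b, c}"] bc assms by blast
      ultimately show False
        using indep_familyD[of "{b, c}" r "\<lambda>a. if a = b then 1 else -1" b] by simp
    qed
  qed
  have "independent (r ` I)"
  proof (subst independent_explicit_finite_subsets, intro allI impI ballI)
    fix A u v assume A: "A \<subseteq> r ` I" "finite A" "(\<Sum>v\<in>A. u v *\<^sub>R v) = 0" "v \<in> A"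
    define J where "J = {b\<in>I. r b \<in> A}"
    have J: "A = r ` J" "J \<subseteq> I" using A by (auto simp: J_def)
    then have "inj_on r J" using inj inj_on_subset by blast
    then have "(\<Sum>b\<in>J. u (r b) *\<^sub>R r b) = 0"
      using A(3) unfolding J by (simp add: sum.reindex o_def)
    from indep_familyD[OF indep_family_mono[OF * J(2) assms] this]
    have "\<forall>b\<in>J. u (r b) = 0" ..
    then show "u v = 0"
      using A(4) J by auto
  qed
  with inj show "inj_on r I \<and> independent (r ` I)" ..
next
  assume *: "inj_on r I \<and> independent (r ` I)"
  show "indep_family I r"
    unfolding indep_family_def
  proof (intro allI impI ballI)
    fix t b assume t: "(\<Sum>b\<in>I. t b *\<^sub>R r b) = 0" "b \<in> I"
    have "(\<Sum>v\<in>r ` I. t (the_inv_into I r v) *\<^sub>R v) = (\<Sum>b\<in>I. t b *\<^sub>R r b)"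
      using * by (subst sum.reindex) (auto simp: the_inv_into_f_f)
    then have "(\<Sum>v\<in>r ` I. t (the_inv_into I r v) *\<^sub>R v) = 0"
      using t by simp
    then have "t (the_inv_into I r (r b)) = 0"
      using * t assms independent_explicit_finite_subsets[of "r ` I"]
      by (meson finite_imageI imageI subset_refl)
    then show "t b = 0"
      using t * by (simp add: the_inv_into_f_f)
  qed
qed

lemma indep_family_card_le:
  fixes r :: "'b \<Rightarrow> 'a::euclidean_space"
  assumes "finite I" "subspace L" "r ` I \<subseteq> L" "indep_family I r"
  shows "card I \<le> dim L"
  using assms by (metis card_image dim_eq_card_independent dim_subset indep_family_iff)

lemma indep_family_span:
  fixes r :: "'b \<Rightarrow> 'a::euclidean_space"
  assumes "finite I" "subspace L" "r ` I \<subseteq> L" "indep_family I r" "dim L \<le> card I"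
  shows "span (r ` I) = L"
proof -
  have "card (r ` I) = card I" "independent (r ` I)"
    using assms by (auto simp: indep_family_iff card_image)
  then have "L \<subseteq> span (r ` I)"
    using assms by (intro card_ge_dim_independent) auto
  then show ?thesis
    using assms by (simp add: span_minimal subset_antisym)
qed

lemma span_indep_family:
  fixes r :: "'b \<Rightarrow> 'a::euclidean_space"
  assumes "finite I" "span (r ` I) = L"
  shows "indep_family I r \<longleftrightarrow> card I = dim L"
proof
  assume "indep_family I r"
  then show "card I = dim L"
    using assms by (metis card_image dim_eq_card dim_span indep_family_iff)
next
  assume c: "card I = dim L"
  have "dim L \<le> card (r ` I)"
    using assms by (metis dim_le_card finite_imageI order_refl span_superset)
  then have ce: "card (r ` I) = card I"
    using c assms card_image_le[of I r] by simp
  then have "inj_on r I"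
    using assms eq_card_imp_inj_on by blast
  moreover have "independent (r ` I)"
    using card_le_dim_spanning[of "r ` I" "r ` I"] assms c ce
    by (metis dim_span finite_imageI order_refl span_superset)
  ultimately show "indep_family I r"
    using assms by (simp add: indep_family_iff)
qed

lemma span_family:
  assumes "finite I" "x \<in> span (r ` I)"
  obtains t where "x = (\<Sum>b\<in>I. t b *\<^sub>R r b)"
proof -
  have "\<exists>t. x = (\<Sum>b\<in>I. t b *\<^sub>R r b)"
    using assms(2)
  proof (induction rule: span_induct_alt)
    case base
    show ?case by (rule exI[of _ "\<lambda>_. 0"]) simp
  next
    case (step c y z)
    then obtain b t where b: "b \<in> I" "y = r b" "z = (\<Sum>b\<in>I. t b *\<^sub>R r b)" by auto
    have "(\<Sum>a\<in>I. (t a + (if a = b then c else 0)) *\<^sub>R r a) = c *\<^sub>R y + z"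
      using b assms(1)
      by (simp add: scaleR_add_left sum.distrib if_distrib[of "\<lambda>x. x *\<^sub>R _"] sum.delta' cong: if_cong)
    then show ?case by metis
  qed
  then show thesis using that by blast
qed

text \<open>
  A nonvanishing term in the Laplace expansion of a determinant, without the determinant.
\<close>

lemma indep_family_transversal:
  fixes v :: "'b \<Rightarrow> 'k \<Rightarrow> real"
  assumes "finite I" "finite K"
    and "\<And>t. (\<And>k. k \<in> K \<Longrightarrow> (\<Sum>b\<in>I. t b * v b k) = 0) \<Longrightarrow> \<forall>b\<in>I. t b = 0"
  shows "\<exists>\<sigma>. inj_on \<sigma> I \<and> (\<forall>b\<in>I. \<sigma> b \<in> K \<and> v b (\<sigma> b) \<noteq> 0)"
  using assms
proof (induction I arbitrary: K rule: finite_induct)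
  case empty
  then show ?case by auto
next
  case (insert b I)
  \<comment> \<open>Expansion along row \<open>b\<close>: a nonzero entry in a column
    \<open>k\<close> whose removal leaves the other rows independent.\<close>
  have "\<exists>k\<in>K. v b k \<noteq> 0 \<and>
          (\<forall>t. (\<forall>l\<in>K - {k}. (\<Sum>c\<in>I. t c * v c l) = 0) \<longrightarrow> (\<forall>c\<in>I. t c = 0))"
  proof (rule ccontr)
    assume contr: "\<not> ?thesis"
    \<comment> \<open>If no such column exists, the other rows span the vector whose only entry is
      \<open>v b k\<close> in column \<open>k\<close>. Summing these over \<open>k\<close> produces
      row \<open>b\<close> itself, contrary to independence.\<close>
    have "\<exists>t. \<forall>l\<in>K. (\<Sum>c\<in>I. t c * v c l) = (if l = k then v b k else 0)" if k: "k \<in> K" for k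
    proof (cases "v b k = 0")
      case True
      then show ?thesis by (intro exI[of _ "\<lambda>_. 0"]) simp
    next
      case False
      with contr k obtain t where t: "\<forall>l\<in>K - {k}. (\<Sum>c\<in>I. t c * v c l) = 0" "\<exists>c\<in>I. t c \<noteq> 0"
        by blast
      define s where "s = (\<Sum>c\<in>I. t c * v c k)"
      have "s \<noteq> 0"
      proof
        assume "s = 0"
        have "(\<Sum>c\<in>insert b I. (if c = b then 0 else t c) * v c l) = 0" if "l \<in> K" for l
        proof -
          have "(\<Sum>c\<in>I. (if c = b then 0 else t c) * v c l) = (\<Sum>c\<in>I. t c * v c l)"
            using insert.hyps by (intro sum.cong) auto
          then show ?thesis
            using t that \<open>s = 0\<close> insert.hyps by (cases "l = k") (auto simp: s_def)
        qed
        then have "\<forall>c\<in>insert b I. (if c = b then 0 else t c) = 0"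
          by (rule insert.prems(2))
        then have z: "(if c = b then 0 else t c) = 0" if "c \<in> I" for c
          using that by (rule bspec[OF _ insertI2])
        have "t c = 0" if "c \<in> I" for c
          using that insert.hyps(2) z[OF that] by (cases "c = b") simp_all
        with t(2) show False by blast
      qed
      have "(\<Sum>c\<in>I. (v b k / s * t c) * v c l) = v b k / s * (\<Sum>c\<in>I. t c * v c l)" for l
        by (simp add: sum_distrib_left mult.assoc)
      then show ?thesis
        using t \<open>s \<noteq> 0\<close> by (intro exI[of _ "\<lambda>c. v b k / s * t c"]) (auto simp: s_def)
    qed
    then obtain T where T: "\<And>k l. k \<in> K \<Longrightarrow> l \<in> K \<Longrightarrow>
        (\<Sum>c\<in>I. T k c * v c l) = (if l = k then v b k else 0)"
      by metis
    define t where "t c = (if c = b then -1 else (\<Sum>k\<in>K. T k c))" for c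
    have "(\<Sum>c\<in>insert b I. t c * v c l) = 0" if "l \<in> K" for l
    proof -
      have "(\<Sum>c\<in>I. t c * v c l) = (\<Sum>c\<in>I. \<Sum>k\<in>K. T k c * v c l)"
        using insert.hyps by (intro sum.cong) (auto simp: t_def sum_distrib_right)
      also have "\<dots> = (\<Sum>k\<in>K. \<Sum>c\<in>I. T k c * v c l)"
        by (rule sum.swap)
      also have "\<dots> = v b l"
        using T that insert.prems(1) by simp
      finally show ?thesis
        using insert.hyps by (simp add: t_def)
    qed
    then have "t b = 0"
      using insert.prems(2) by blast
    then show False by (simp add: t_def)
  qed
  then obtain k where k: "k \<in> K" "v b k \<noteq> 0"
      "\<And>t. (\<And>l. l \<in> K - {k} \<Longrightarrow> (\<Sum>c\<in>I. t c * v c l) = 0) \<Longrightarrow> \<forall>c\<in>I. t c = 0"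
    by blast
  then obtain \<sigma> where \<sigma>: "inj_on \<sigma> I" "\<forall>c\<in>I. \<sigma> c \<in> K - {k} \<and> v c (\<sigma> c) \<noteq> 0"
    using insert.IH[of "K - {k}"] insert.prems(1) by auto
  have "inj_on (\<sigma>(b := k)) (insert b I)"
    using \<sigma> insert.hyps by (auto simp: inj_on_def)
  moreover have "(\<sigma>(b := k)) c \<in> K \<and> v c ((\<sigma>(b := k)) c) \<noteq> 0" if "c \<in> insert b I" for c
    using that \<sigma>(2) k(1,2) insert.hyps by (cases "c = b") auto
  ultimately show ?case by blast
qed


section \<open>Equilibrium and rigidity at a configuration\<close>

definition loads :: "'v::finite set \<Rightarrow> (real^2^'v) set" where
  "loads V = {F \<in> configs V. (\<Sum>i\<in>V. F $ i) = 0}"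

definition restrict_config :: "'v set \<Rightarrow> real^2^'v::finite \<Rightarrow> real^2^'v" where
  "restrict_config U X = (\<chi> i. if i \<in> U then X $ i else 0)"

lemma subspace_configs: "subspace (configs V)"
  by (auto simp: subspace_def configs_def)

lemma subspace_loads: "subspace (loads V)"
  by (auto simp: subspace_def loads_def configs_def sum.distrib simp flip: scaleR_sum_right)

lemma restrict_config_in: "restrict_config U X \<in> configs U"
  by (simp add: restrict_config_def configs_def)

lemma restrict_config_id: "X \<in> configs U \<Longrightarrow> restrict_config U X = X"
  by (auto simp: restrict_config_def configs_def vec_eq_iff)

lemma configs_mono: "U \<subseteq> V \<Longrightarrow> configs U \<subseteq> configs V"
  by (auto simp: configs_def)

lemma polynomial_restrict_config: "polynomial_function (restrict_config U)"
  unfolding polynomial_function_vec2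
proof (intro allI)
  fix i k
  show "real_polynomial_function (\<lambda>X. restrict_config U X $ i $ k)"
    using real_polynomial_function_vec_nth[OF polynomial_function_vec_nth[OF polynomial_function_id]]
    by (cases "i \<in> U") (auto simp: restrict_config_def id_def)
qed

text \<open>Forgetting coordinates maps \<open>configs V\<close> onto \<open>configs U\<close>; this
  transfers generic properties of a subgraph to the configurations of the whole graph.\<close>

lemma generically_restrict_config:
  assumes "generically (configs U) P" "U \<subseteq> V"
  shows "generically (configs V) (\<lambda>X. P (restrict_config U X))"
  using assms(1) polynomial_restrict_config restrict_config_in
  by (rule generically_compose) (use configs_mono[OF assms(2)] restrict_config_id in blast)

lemma axis_diff_in_loads:
  assumes "i \<in> V" "j \<in> V"
  shows "axis i y - axis j y \<in> loads V"
proof -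
  have "(\<Sum>k\<in>V. axis i y $ k) = y" if "i \<in> V" for i :: "'a" and y :: "real^2"
    using that by (simp add: axis_def sum.delta)
  then show ?thesis
    using assms by (auto simp: loads_def configs_def sum_subtractf) (auto simp: axis_def)
qed

text \<open>A basis consists of the unit forces at the vertices other than a base vertex
  \<open>w\<close>, each balanced by its opposite at \<open>w\<close>. Coefficients can be read off
  away from \<open>w\<close>.\<close>

lemma dim_loads:
  assumes "V \<noteq> {}"
  shows "dim (loads V) = 2 * card V - 2"
proof -
  obtain w where w: "w \<in> V" using assms by blast
  define e :: "'a \<times> 2 \<Rightarrow> real^2^'a" where "e = (\<lambda>(i, k). axis i (axis k 1) - axis w (axis k 1))"
  define I where "I = (V - {w}) \<times> (UNIV :: 2 set)"
  have I: "finite I" by (simp add: I_def)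
  have comb: "(\<Sum>p\<in>I. t p *\<^sub>R e p) =
      (\<Sum>i\<in>V - {w}. axis i (\<chi> k. t (i, k)) - axis w (\<chi> k. t (i, k)))" for t
  proof -
    have "(\<Sum>p\<in>I. t p *\<^sub>R e p) = (\<Sum>i\<in>V - {w}. \<Sum>k\<in>UNIV. t (i, k) *\<^sub>R e (i, k))"
      unfolding I_def by (simp add: sum.cartesian_product)
    moreover have "(\<Sum>k\<in>UNIV. t (i, k) *\<^sub>R e (i, k)) =
        axis i (\<chi> k. t (i, k)) - axis w (\<chi> k. t (i, k))" for i
      by (auto simp: e_def sum_2 vec_eq_iff axis_def forall_2)
    ultimately show ?thesis by simp
  qed
  have nth: "(\<Sum>i\<in>V - {w}. axis i (f i) - axis w (f i)) $ j = f j"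
    if "j \<in> V" "j \<noteq> w" for f :: "'a \<Rightarrow> real^2" and j
    using that by (simp add: axis_def sum.delta if_distrib[of "\<lambda>x. x $ _"] cong: if_cong)
  have "indep_family I e"
    unfolding indep_family_def
  proof (intro allI impI ballI)
    fix t p assume t: "(\<Sum>p\<in>I. t p *\<^sub>R e p) = 0" "p \<in> I"
    then have "fst p \<in> V" "fst p \<noteq> w"
      by (auto simp: I_def)
    then have "(\<chi> k. t (fst p, k)) = (0 :: real^2)"
      using nth[of "fst p" "\<lambda>i. \<chi> k. t (i, k)"] t(1) unfolding comb by simp
    then show "t p = 0"
      by (metis prod.collapse vec_lambda_beta zero_index)
  qed
  moreover have "span (e ` I) = loads V"
  proof
    show "span (e ` I) \<subseteq> loads V"
      using axis_diff_in_loads[of _ V w] w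
      by (intro span_minimal subspace_loads) (auto simp: e_def I_def)
    show "loads V \<subseteq> span (e ` I)"
    proof
      fix F assume F: "F \<in> loads V"
      have sum0: "(\<Sum>i\<in>V - {w}. F $ i) = - F $ w"
        using F w by (simp add: loads_def sum_diff1 eq_neg_iff_add_eq_0)
      have "F = (\<Sum>i\<in>V - {w}. axis i (F $ i) - axis w (F $ i))"
      proof (rule iffD2[OF vec_eq_iff], rule allI)
        fix j
        consider "j \<in> V" "j \<noteq> w" | "j = w" | "j \<notin> V" "j \<noteq> w" using w by blast
        then show "F $ j = (\<Sum>i\<in>V - {w}. axis i (F $ i) - axis w (F $ i)) $ j"
        proof cases
          case 1
          then show ?thesis using nth[of j "\<lambda>i. F $ i"] by simp
        next
          case 2
          have "(axis i (F $ i) - axis w (F $ i)) $ w = - F $ i" if "i \<in> V - {w}" for i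
            using that by (auto simp: axis_def)
          then show ?thesis
            using sum0 2 by (simp add: sum_negf)
        next
          case 3
          then have "(axis i (F $ i) - axis w (F $ i)) $ j = 0" if "i \<in> V - {w}" for i
            using that by (auto simp: axis_def)
          then have "(\<Sum>i\<in>V - {w}. axis i (F $ i) - axis w (F $ i)) $ j = 0"
            by simp
          then show ?thesis
            using F 3 by (simp add: loads_def configs_def)
        qed
      qed
      also have "\<dots> = (\<Sum>p\<in>I. (F $ fst p $ snd p) *\<^sub>R e p)"
        by (simp add: comb)
      also have "\<dots> \<in> span (e ` I)"
        by (intro span_sum span_scale span_base) auto
      finally show "F \<in> span (e ` I)" .
    qed
  qed
  ultimately have "card I = dim (loads V)"
    using span_indep_family[OF I] by blast
  then show ?thesis
    using w by (simp add: I_def card_cartesian_product card_Diff_singleton)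
qed

section \<open>Rigidity and independence at a single configuration\<close>

locale torus_graph = fin_digraph G
  for G :: "('v::finite, 'e) pre_digraph" +
  fixes L1 L2 :: "real^2" and m :: "'e \<Rightarrow> gain"
begin

abbreviation "dvec \<equiv> edge_vec L1 L2 m G"
abbreviation "strain \<equiv> compat L1 L2 m G"
abbreviation "net_force \<equiv> equilibrium L1 L2 m G"

definition row :: "real^2^'v \<Rightarrow> 'e \<Rightarrow> real^2^'v" where
  "row X b = axis (head G b) (dvec X b) - axis (tail G b) (dvec X b)"

definition inf_rigid :: "real^2^'v \<Rightarrow> bool" where
  "inf_rigid X \<longleftrightarrow> zero_modes L1 L2 m G X \<subseteq> trivial_zero_modes G"

definition stress_free :: "real^2^'v \<Rightarrow> bool" where
  "stress_free X \<longleftrightarrow> indep_family (arcs G) (row X)"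

lemma row_inner: "row X b \<bullet> u = strain X u b"
  by (simp add: row_def compat_def inner_diff_left inner_diff_right inner_axis')

lemma row_in_loads: "b \<in> arcs G \<Longrightarrow> row X b \<in> loads (verts G)"
  unfolding row_def by (intro axis_diff_in_loads) auto

lemma rows_subset: "row X ` arcs G \<subseteq> loads (verts G)"
  using row_in_loads by blast

lemma net_force_rows: "net_force X t = (\<Sum>b\<in>arcs G. t b *\<^sub>R row X b)"
proof -
  have "net_force X t \<bullet> u = (\<Sum>b\<in>arcs G. t b *\<^sub>R row X b) \<bullet> u" for u
    by (simp add: equilibrium_adjoint_compat inner_sum_left row_inner)
  then show ?thesis
    using vector_eq_rdot by blast
qed

lemma net_force_inner: "net_force X t \<bullet> u = (\<Sum>b\<in>arcs G. t b * strain X u b)"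
  by (simp add: equilibrium_adjoint_compat)

lemma net_force_in_loads: "net_force X t \<in> loads (verts G)"
  unfolding net_force_rows
  by (intro subspace_sum subspace_scale subspace_loads row_in_loads)

lemma stress_freeD:
  "\<lbrakk>stress_free X; net_force X t = net_force X s; b \<in> arcs G\<rbrakk> \<Longrightarrow> t b = s b"
  using indep_familyD[of "arcs G" "row X" "\<lambda>b. t b - s b" b]
  by (simp add: stress_free_def net_force_rows scaleR_diff_left sum_subtractf)

text \<open>Duality: zero modes are orthogonal to the rows, translations to \<open>loads\<close>. A
  load orthogonal to all rows is a zero mode, hence constant by rigidity, hence zero because its sum
  is zero. Conversely, orthogonality to a pair of opposite forces at \<open>i\<close> and
  \<open>j\<close> compares \<open>u $ i\<close> with \<open>u $ j\<close>.\<close>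

lemma inf_rigid_iff_span: "inf_rigid X \<longleftrightarrow> span (row X ` arcs G) = loads (verts G)"
proof
  have sub: "span (row X ` arcs G) \<subseteq> loads (verts G)"
    using row_in_loads by (intro span_minimal subspace_loads) auto
  assume rig: "inf_rigid X"
  show "span (row X ` arcs G) = loads (verts G)"
  proof (rule ccontr)
    assume "span (row X ` arcs G) \<noteq> loads (verts G)"
    with sub have "span (row X ` arcs G) \<subset> span (loads (verts G))"
      by (simp add: psubset_eq span_eq_iff[THEN iffD2, OF subspace_loads])
    then obtain u where u: "u \<noteq> 0" "u \<in> span (loads (verts G))"
        "\<And>y. y \<in> span (row X ` arcs G) \<Longrightarrow> orthogonal u y"
      using orthogonal_to_subspace_exists_gen by metis
    then have u2: "u \<in> loads (verts G)"
      using span_eq_iff subspace_loads by blast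
    have "row X b \<bullet> u = 0" if "b \<in> arcs G" for b
      using u(3)[of "row X b"] that by (simp add: span_base orthogonal_def inner_commute)
    then have "u \<in> zero_modes L1 L2 m G X"
      using u2 by (simp add: zero_modes_def loads_def row_inner)
    then have const: "\<forall>i\<in>verts G. \<forall>j\<in>verts G. u $ i = u $ j"
      using rig by (auto simp: inf_rigid_def trivial_zero_modes_def)
    have "u $ i = 0" for i
    proof (cases "i \<in> verts G")
      case True
      then have "(\<Sum>j\<in>verts G. u $ j) = (\<Sum>j\<in>verts G. u $ i)"
        using const True by (intro sum.cong refl) blast
      then show ?thesis
        using u2 True by (auto simp: loads_def sum_constant_scaleR simp del: sum_constant)
    qed (use u2 in \<open>auto simp: loads_def configs_def\<close>)
    with u(1) show False by (simp add: vec_eq_iff)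
  qed
next
  assume sp: "span (row X ` arcs G) = loads (verts G)"
  show "inf_rigid X"
    unfolding inf_rigid_def
  proof
    fix u assume u: "u \<in> zero_modes L1 L2 m G X"
    have orth: "F \<bullet> u = 0" if "F \<in> loads (verts G)" for F
    proof -
      obtain t where "F = (\<Sum>b\<in>arcs G. t b *\<^sub>R row X b)"
        using span_family[OF finite_arcs] \<open>F \<in> loads (verts G)\<close> sp by metis
      then show ?thesis
        using u by (simp add: inner_sum_left row_inner zero_modes_def)
    qed
    have "u $ i = u $ j" if "i \<in> verts G" "j \<in> verts G" for i j
    proof -
      have "(axis i y - axis j y) \<bullet> u = y \<bullet> (u $ i - u $ j)" for y
        by (simp add: inner_diff_left inner_diff_right inner_axis')
      then have "(u $ i - u $ j) \<bullet> (u $ i - u $ j) = 0"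
        using orth[OF axis_diff_in_loads[OF that]] by metis
      then show ?thesis by simp
    qed
    then show "u \<in> trivial_zero_modes G"
      using u unfolding trivial_zero_modes_def zero_modes_def by blast
  qed
qed

text \<open>At a rigid configuration the rows span \<open>loads\<close>, so independence is a count,
  the same for all rigid configurations.\<close>

lemma stress_free_iff_card:
  "inf_rigid X \<Longrightarrow> stress_free X \<longleftrightarrow> card (arcs G) = dim (loads (verts G))"
  unfolding stress_free_def inf_rigid_iff_span by (rule span_indep_family[OF finite_arcs])

lemma card_arcs_le: "stress_free X \<Longrightarrow> card (arcs G) \<le> dim (loads (verts G))"
  unfolding stress_free_def
  using indep_family_card_le[OF finite_arcs subspace_loads rows_subset] by blast

lemma stress_free_inf_rigid:
  "\<lbrakk>stress_free X; dim (loads (verts G)) \<le> card (arcs G)\<rbrakk> \<Longrightarrow> inf_rigid X"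
  unfolding stress_free_def inf_rigid_iff_span
  using indep_family_span[OF finite_arcs subspace_loads rows_subset] by blast

text \<open>
  The second summand makes \<open>Q C\<close> invertible on translations and on the irrelevant coordinates outside
  \<open>verts G\<close>.
\<close>

definition stiffness :: "real^2^'v \<Rightarrow> real^2^'v \<Rightarrow> real^2^'v" where
  "stiffness X u = net_force X (strain X u) +
     (\<chi> i. if i \<in> verts G then (\<Sum>j\<in>verts G. u $ j) else u $ i)"

lemma linear_stiffness: "linear (stiffness X)"
proof
  fix u v c
  have "strain X (u + v) b = strain X u b + strain X v b" for b
    by (simp add: compat_def inner_add_right inner_diff_right)
  then have "net_force X (strain X (u + v)) = net_force X (strain X u) + net_force X (strain X v)"
    by (simp add: net_force_rows scaleR_add_left sum.distrib)
  then show "stiffness X (u + v) = stiffness X u + stiffness X v"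
    by (simp add: stiffness_def vec_eq_iff sum.distrib)
  have "strain X (c *\<^sub>R u) b = c * strain X u b" for b
    by (simp add: compat_def inner_diff_right right_diff_distrib)
  then have "net_force X (strain X (c *\<^sub>R u)) = c *\<^sub>R net_force X (strain X u)"
    by (simp add: net_force_rows scaleR_sum_right)
  then show "stiffness X (c *\<^sub>R u) = c *\<^sub>R stiffness X u"
    by (simp add: stiffness_def vec_eq_iff sum_distrib_left distrib_left)
qed

text \<open>The quadratic form is a sum of squares, so on the kernel of \<open>stiffness\<close>
  each of the three terms vanishes separately.\<close>

lemma stiffness_inner:
  "stiffness X u \<bullet> u = (\<Sum>b\<in>arcs G. (strain X u b)\<^sup>2) + (norm (\<Sum>j\<in>verts G. u $ j))\<^sup>2
     + (\<Sum>i\<in>-verts G. (norm (u $ i))\<^sup>2)"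
proof -
  have "(\<chi> i. if i \<in> verts G then (\<Sum>j\<in>verts G. u $ j) else u $ i) \<bullet> u
      = (\<Sum>i\<in>verts G \<union> -verts G. (if i \<in> verts G then (\<Sum>j\<in>verts G. u $ j) else u $ i) \<bullet> u $ i)"
    by (simp add: inner_vec_def)
  also have "\<dots> = (\<Sum>i\<in>verts G. (\<Sum>j\<in>verts G. u $ j) \<bullet> u $ i) + (\<Sum>i\<in>-verts G. u $ i \<bullet> u $ i)"
    by (subst sum.union_disjoint) auto
  finally show ?thesis
    by (simp add: stiffness_def inner_add_left net_force_inner power2_eq_square[of "strain _ _ _"]
        power2_norm_eq_inner flip: inner_sum_right)
qed

lemma stiffness_kernel: "(\<forall>u. stiffness X u = 0 \<longrightarrow> u = 0) \<longleftrightarrow> inf_rigid X"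
proof
  assume inj: "\<forall>u. stiffness X u = 0 \<longrightarrow> u = 0"
  show "inf_rigid X"
    unfolding inf_rigid_def
  proof
    fix u assume u: "u \<in> zero_modes L1 L2 m G X"
    \<comment> \<open>Subtracting the mean displacement makes the second summand of
      \<open>stiffness\<close> vanish and leaves all strains unchanged.\<close>
    define c where "c = (\<Sum>j\<in>verts G. u $ j) /\<^sub>R real (card (verts G))"
    define u' where "u' = u - (\<chi> i. if i \<in> verts G then c else 0)"
    have "strain X u' b = 0" if "b \<in> arcs G" for b
    proof -
      have "strain X u' b = strain X u b"
        using that by (simp add: compat_def u'_def)
      then show ?thesis using u that by (simp add: zero_modes_def)
    qed
    then have "net_force X (strain X u') = 0"
      by (simp add: net_force_rows)
    moreover have "(\<Sum>j\<in>verts G. u' $ j) = 0"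
      by (cases "verts G = {}")
        (simp_all add: u'_def sum_subtractf sum_constant_scaleR c_def del: sum_constant)
    moreover have "u' $ i = 0" if "i \<notin> verts G" for i
      using that u by (simp add: u'_def zero_modes_def configs_def)
    ultimately have "stiffness X u' = 0"
      by (simp add: stiffness_def vec_eq_iff)
    with inj have "u' = 0" by blast
    then have "u = (\<chi> i. if i \<in> verts G then c else 0)"
      by (simp add: u'_def)
    then show "u \<in> trivial_zero_modes G"
      using u by (auto simp: trivial_zero_modes_def zero_modes_def)
  qed
next
  assume rig: "inf_rigid X"
  show "\<forall>u. stiffness X u = 0 \<longrightarrow> u = 0"
  proof (intro allI impI)
    fix u assume "stiffness X u = 0"
    then have "(\<Sum>b\<in>arcs G. (strain X u b)\<^sup>2) + (norm (\<Sum>j\<in>verts G. u $ j))\<^sup>2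
        + (\<Sum>i\<in>-verts G. (norm (u $ i))\<^sup>2) = 0"
      by (simp flip: stiffness_inner)
    moreover have "(\<Sum>b\<in>arcs G. (strain X u b)\<^sup>2) \<ge> 0" "(\<Sum>i\<in>-verts G. (norm (u $ i))\<^sup>2) \<ge> 0"
      by (simp_all add: sum_nonneg)
    ultimately have "(\<Sum>b\<in>arcs G. (strain X u b)\<^sup>2) = 0" and s0: "(\<Sum>j\<in>verts G. u $ j) = 0"
      and "(\<Sum>i\<in>-verts G. (norm (u $ i))\<^sup>2) = 0"
      by (smt (verit) zero_le_power2 power2_less_eq_zero_iff norm_eq_zero)+
    then have "\<forall>b\<in>arcs G. strain X u b = 0" and out: "\<forall>i\<in>-verts G. u $ i = 0"
      by (simp_all add: sum_nonneg_eq_0_iff)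
    then have "u \<in> zero_modes L1 L2 m G X"
      by (simp add: zero_modes_def configs_def)
    then have const: "\<forall>i\<in>verts G. \<forall>j\<in>verts G. u $ i = u $ j"
      using rig by (auto simp: inf_rigid_def trivial_zero_modes_def)
    have "u $ i = 0" for i
    proof (cases "i \<in> verts G")
      case True
      then have "(\<Sum>j\<in>verts G. u $ j) = (\<Sum>j\<in>verts G. u $ i)"
        using const True by (intro sum.cong refl) blast
      then show ?thesis
        using s0 True by (auto simp: sum_constant_scaleR simp del: sum_constant)
    qed (use out in auto)
    then show "u = 0" by (simp add: vec_eq_iff)
  qed
qed

text \<open>The polynomial that is nonzero exactly at the rigid configurations; it is also the
  common denominator of all tensions.\<close>

definition stiffness_det :: "real^2^'v \<Rightarrow> real" where
  "stiffness_det X = det (flat_matrix (stiffness X))"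

lemma stiffness_det_nonzero: "stiffness_det X \<noteq> 0 \<longleftrightarrow> inf_rigid X"
  unfolding stiffness_det_def by (simp only: det_flat_matrix_nonzero[OF linear_stiffness] stiffness_kernel)

lemma polynomial_dvec:
  assumes "polynomial_function X"
  shows "real_polynomial_function (\<lambda>p. dvec (X p) b $ k)"
  unfolding edge_vec_def
  by (intro real_polynomial_function_vec_nth polynomial_function_diff polynomial_function_add
      polynomial_function_vec_nth assms polynomial_function_const)

lemma polynomial_stiffness:
  fixes X :: "'p::euclidean_space \<Rightarrow> real^2^'v"
  assumes X: "polynomial_function X"
  shows "real_polynomial_function (\<lambda>p. stiffness (X p) u $ i $ k)"
proof -
  have "real_polynomial_function (\<lambda>p. strain (X p) u b * row (X p) b $ i $ k)" for b
  proof (intro real_polynomial_function.intros(4))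
    have "strain (X p) u b = (\<Sum>l\<in>UNIV. dvec (X p) b $ l * (u $ head G b - u $ tail G b) $ l)" for p
      by (simp add: compat_def inner_vec_def)
    then show "real_polynomial_function (\<lambda>p. strain (X p) u b)"
      using polynomial_dvec[OF X]
      by (simp add: real_polynomial_function_sum real_polynomial_function.intros(2,4))
    have "row (X p) b $ i $ k = (if head G b = i then 1 else 0) * dvec (X p) b $ k
        - (if tail G b = i then 1 else 0) * dvec (X p) b $ k" for p
      by (simp add: row_def axis_def)
    then show "real_polynomial_function (\<lambda>p. row (X p) b $ i $ k)"
      using polynomial_dvec[OF X] by auto
  qed
  then have "real_polynomial_function (\<lambda>p. \<Sum>b\<in>arcs G. strain (X p) u b * row (X p) b $ i $ k)"
    by (intro real_polynomial_function_sum finite_arcs)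
  then show ?thesis
    by (simp add: stiffness_def net_force_rows real_polynomial_function.intros(2,3))
qed

lemma polynomial_stiffness_det: "real_polynomial_function stiffness_det"
  unfolding stiffness_det_def[abs_def] flat_matrix_def
  by (rule polynomial_det)
    (use polynomial_stiffness[OF polynomial_function_id, unfolded id_def] in simp)

text \<open>Tensions are sought in the form \<open>C u\<close>, which replaces the rectangular
  system \<open>Q t = F\<close> by a square one and makes Cramer's rule applicable. Where tensions
  are unique, nothing is lost by this choice. The value outside \<open>arcs G\<close> places it in
  \<open>tensions\<close>.\<close>

definition response :: "real^2^'v \<Rightarrow> real^2^'v \<Rightarrow> 'e \<Rightarrow> real" where
  "response X F b = (if b \<in> arcs G then strain X (SOME u. stiffness X u = F) b else 0)"

lemma stiffness_solution:
  assumes "inf_rigid X"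
  shows "stiffness X (SOME u. stiffness X u = F) = F"
proof -
  have "inj (stiffness X)"
    using assms linear_injective_0[OF linear_stiffness] stiffness_kernel by blast
  then have "surj (stiffness X)"
    by (rule linear_injective_imp_surjective[OF linear_stiffness]) simp
  then have "\<exists>u. stiffness X u = F" by (metis surjD)
  then show ?thesis by (rule someI_ex)
qed

text \<open>Summed over the vertices, \<open>F\<close> and \<open>Q C u\<close> both give zero.
  Hence the correction term of \<open>stiffness\<close> vanishes on the vertices, and
  \<open>Q C u\<close> alone balances \<open>F\<close>.\<close>

lemma net_force_response:
  assumes X: "inf_rigid X" and F: "F \<in> loads (verts G)"
  shows "net_force X (response X F) = F"
proof -
  define u where "u = (SOME u. stiffness X u = F)"
  have u: "stiffness X u = F"
    unfolding u_def using X by (rule stiffness_solution)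
  have Q: "net_force X (strain X u) \<in> loads (verts G)"
    by (rule net_force_in_loads)
  have *: "F $ i = net_force X (strain X u) $ i +
      (if i \<in> verts G then (\<Sum>j\<in>verts G. u $ j) else u $ i)" for i
    unfolding u[symmetric] by (simp add: stiffness_def)
  have "(\<Sum>i\<in>verts G. F $ i) = (\<Sum>i\<in>verts G. net_force X (strain X u) $ i)
      + (\<Sum>i\<in>verts G. (\<Sum>j\<in>verts G. u $ j))"
    unfolding sum.distrib[symmetric] using * by (intro sum.cong) auto
  then have "verts G = {} \<or> (\<Sum>j\<in>verts G. u $ j) = 0"
    using F Q by (auto simp: loads_def sum_constant_scaleR simp del: sum_constant)
  then have "F $ i = net_force X (strain X u) $ i" for i
    using *[of i] F Q by (auto simp: loads_def configs_def)
  then have "F = net_force X (strain X u)"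
    by (simp add: vec_eq_iff)
  then show ?thesis
    unfolding response_def u_def[symmetric] by (simp add: net_force_rows)
qed

lemma response_eqI:
  assumes "stress_free X" "inf_rigid X" "net_force X t = F" "b \<in> arcs G"
  shows "response X F b = t b"
  using assms net_force_response[of X F] net_force_in_loads[of X t] stress_freeD[of X] by metis

text \<open>Stated along a polynomial family of configurations and loads, so that the load may be
  constant, depend on the configuration, or be an independent parameter.\<close>

lemma polynomial_response:
  fixes X F :: "'p::euclidean_space \<Rightarrow> real^2^'v"
  assumes X: "polynomial_function X" and F: "polynomial_function F"
  obtains N where "real_polynomial_function N"
    and "\<And>p. inf_rigid (X p) \<Longrightarrow> response (X p) (F p) b * stiffness_det (X p) = N p"
proof -
  obtain M where M: "\<And>i k. real_polynomial_function (M i k)"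
      "\<And>p u i k. \<lbrakk>stiffness_det (X p) \<noteq> 0; stiffness (X p) u = F p\<rbrakk> \<Longrightarrow>
         u $ i $ k * stiffness_det (X p) = M i k p"
    using polynomial_cramer[of "\<lambda>p. stiffness (X p)" F] linear_stiffness polynomial_stiffness[OF X]
      F[unfolded polynomial_function_vec2] unfolding stiffness_det_def by blast
  define N where "N p = (if b \<in> arcs G then
      (\<Sum>k\<in>UNIV. dvec (X p) b $ k * (M (head G b) k p - M (tail G b) k p)) else 0)" for p
  show thesis
  proof
    show "real_polynomial_function N"
      unfolding N_def using polynomial_dvec[OF X] M(1)
      by (cases "b \<in> arcs G") (simp_all add: real_polynomial_function_sum
          real_polynomial_function.intros(2,4) real_polynomial_function_diff)
    fix p assume rig: "inf_rigid (X p)"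
    then have nz: "stiffness_det (X p) \<noteq> 0" by (simp add: stiffness_det_nonzero)
    show "response (X p) (F p) b * stiffness_det (X p) = N p"
      by (simp add: response_def N_def compat_def inner_vec_def sum_distrib_right left_diff_distrib
          mult.assoc right_diff_distrib flip: M(2)[OF nz stiffness_solution[OF rig]])
  qed
qed

lemma inf_rigid_generic:
  assumes "inf_rigid X" "X \<in> configs (verts G)"
  shows "generically (configs (verts G)) inf_rigid"
  using generically_nonzero[OF polynomial_stiffness_det assms(2)] assms(1)
  by (simp add: stiffness_det_nonzero)

section \<open>Isostaticity from one configuration, and subgraphs\<close>

lemma strain_del_arc: "compat L1 L2 m (del_arc b) = strain"
  by (intro ext) (simp add: compat_def edge_vec_def)

lemma zero_modes_del_arc:
  "zero_modes L1 L2 m (del_arc b) X =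
     {u \<in> configs (verts G). \<forall>c\<in>arcs G - {b}. strain X u c = 0}"
  by (simp add: zero_modes_def strain_del_arc)

text \<open>A self stress is orthogonal to all strains. If it were nonzero on \<open>b\<close>, a
  nontrivial motion of \<open>G - b\<close> could not strain \<open>b\<close> either and would be a
  motion of \<open>G\<close>.\<close>

lemma isostaticD:
  assumes "isostatic L1 L2 m G"
  obtains X where "X \<in> configs (verts G)" "inf_rigid X" "stress_free X"
proof -
  have "generically (configs (verts G)) (\<lambda>X. inf_rigid X \<and>
      (\<forall>b\<in>arcs G. \<exists>u\<in>zero_modes L1 L2 m (del_arc b) X. u \<notin> trivial_zero_modes G))"
    using assms unfolding isostatic_def rigid_def inf_rigid_def
    by (intro generically_conj generically_ball subspace_configs)
      (auto simp: subspace_0[OF subspace_configs] intro: subspace_0[OF subspace_configs])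
  then obtain X where X: "X \<in> configs (verts G)" "inf_rigid X"
      "\<And>b. b \<in> arcs G \<Longrightarrow> \<exists>u\<in>zero_modes L1 L2 m (del_arc b) X. u \<notin> trivial_zero_modes G"
    using generically_ex by blast
  have "stress_free X"
    unfolding stress_free_def indep_family_def
  proof (intro allI impI ballI, rule ccontr)
    fix t b assume t: "(\<Sum>b\<in>arcs G. t b *\<^sub>R row X b) = 0" "b \<in> arcs G" "t b \<noteq> 0"
    obtain u where u: "u \<in> zero_modes L1 L2 m (del_arc b) X" "u \<notin> trivial_zero_modes G"
      using X(3) t(2) by blast
    have "0 = (\<Sum>c\<in>arcs G. t c * strain X u c)"
      using t(1) by (simp flip: net_force_rows net_force_inner)
    also have "\<dots> = t b * strain X u b + (\<Sum>c\<in>arcs G - {b}. t c * strain X u c)"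
      using t(2) by (simp add: sum.remove)
    also have "(\<Sum>c\<in>arcs G - {b}. t c * strain X u c) = 0"
      using u(1) by (intro sum.neutral) (simp add: zero_modes_del_arc)
    finally have "strain X u b = 0"
      using t(3) by simp
    then have "u \<in> zero_modes L1 L2 m G X"
      using u(1) unfolding zero_modes_del_arc by (auto simp: zero_modes_def)
    then show False
      using u(2) X(2) unfolding inf_rigid_def by blast
  qed
  with X(1,2) show thesis by (rule that)
qed

text \<open>Such a \<open>u\<close> is a zero mode of \<open>G - b\<close>.\<close>

lemma ex_strain_single:
  assumes X: "inf_rigid X" "stress_free X" and b: "b \<in> arcs G"
  obtains u where "u \<in> configs (verts G)" "\<And>c. c \<in> arcs G \<Longrightarrow> strain X u c = (if c = b then 1 else 0)"
    "\<And>F. F \<in> loads (verts G) \<Longrightarrow> F \<bullet> u = response X F b"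
proof -
  \<comment> \<open>The load carried by unit tension on \<open>b\<close> alone. By uniqueness its
    response is that tension, and a response is by construction a strain, here that of
    \<open>v\<close>.\<close>
  define F where "F = net_force X (\<lambda>c. if c = b then 1 else 0)"
  define v where "v = (SOME u. stiffness X u = F)"
  define u where "u = restrict_config (verts G) v"
  have eq: "response X F c = (if c = b then 1 else 0)" if "c \<in> arcs G" for c
    using response_eqI[OF X(2,1) F_def[symmetric] that] .
  have "strain X u c = strain X v c" if "c \<in> arcs G" for c
    using that by (simp add: compat_def u_def restrict_config_def)
  then have str: "strain X u c = (if c = b then 1 else 0)" if "c \<in> arcs G" for c
    using eq[OF that] that by (simp add: response_def v_def)
  \<comment> \<open>Reciprocity: since only \<open>b\<close> is strained, the virtual work of
    \<open>F'\<close> along \<open>u\<close> is the tension of \<open>b\<close> under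
    \<open>F'\<close>.\<close>
  have "F' \<bullet> u = response X F' b" if F': "F' \<in> loads (verts G)" for F'
  proof -
    have "F' \<bullet> u = (\<Sum>c\<in>arcs G. response X F' c * strain X u c)"
      by (subst net_force_response[OF X(1) F', symmetric]) (rule net_force_inner)
    also have "\<dots> = (\<Sum>c\<in>arcs G. if c = b then response X F' c else 0)"
      by (intro sum.cong) (auto simp: str)
    finally show ?thesis using b by simp
  qed
  with restrict_config_in str show thesis
    unfolding u_def by (rule that)
qed

text \<open>One configuration suffices: rigidity spreads to generic configurations because
  \<open>stiffness_det\<close> is a polynomial, and at rigid configurations independence is a count.
  A mode that strains only \<open>b\<close> is then the required motion of
  \<open>G - b\<close>.\<close>

lemma isostaticI:
  assumes X: "X \<in> configs (verts G)" "inf_rigid X" "stress_free X"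
  shows "isostatic L1 L2 m G"
  unfolding isostatic_def rigid_def
proof (intro conjI ballI)
  have gen: "generically (configs (verts G)) inf_rigid"
    using X inf_rigid_generic by blast
  then show "generically (configs (verts G)) (\<lambda>X. zero_modes L1 L2 m G X \<subseteq> trivial_zero_modes G)"
    by (simp add: inf_rigid_def[abs_def])
  fix b assume b: "b \<in> arcs G"
  show "generically (configs (verts G))
      (\<lambda>X. \<exists>u\<in>zero_modes L1 L2 m (del_arc b) X. u \<notin> trivial_zero_modes G)"
    using gen
  proof (rule generically_mono)
    fix Y assume Y: "inf_rigid Y"
    then have "stress_free Y"
      using X stress_free_iff_card by blast
    then obtain u where u: "u \<in> configs (verts G)"
        "\<And>c. c \<in> arcs G \<Longrightarrow> strain Y u c = (if c = b then 1 else 0)"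
      by (rule ex_strain_single[OF Y _ b]) (rule that)
    have "u \<notin> trivial_zero_modes G"
    proof
      assume "u \<in> trivial_zero_modes G"
      then have "u $ head G b = u $ tail G b"
        using head_in_verts[OF b] tail_in_verts[OF b] unfolding trivial_zero_modes_def by blast
      then show False
        using u(2)[OF b] by (simp add: compat_def)
    qed
    then show "\<exists>u\<in>zero_modes L1 L2 m (del_arc b) Y. u \<notin> trivial_zero_modes G"
      using u by (intro bexI[of _ u]) (auto simp: zero_modes_del_arc)
  qed
qed

lemma row_restrict: "b \<in> arcs G \<Longrightarrow> row (restrict_config (verts G) X) b = row X b"
  by (simp add: row_def edge_vec_def restrict_config_def)

lemma stress_free_restrict: "stress_free (restrict_config (verts G) X) \<longleftrightarrow> stress_free X"
  by (simp add: stress_free_def indep_family_def row_restrict)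

lemma inf_rigid_restrict: "inf_rigid (restrict_config (verts G) X) \<longleftrightarrow> inf_rigid X"
  by (simp add: inf_rigid_iff_span row_restrict)

lemma torus_subgraph: "subgraph H G \<Longrightarrow> torus_graph H"
  using finite_subset[OF _ finite_arcs] finite_subset[OF _ finite_verts]
  by (simp add: torus_graph_def fin_digraph_def fin_digraph_axioms_def subgraph_def)

lemma row_subgraph: "subgraph H G \<Longrightarrow> torus_graph.row H L1 L2 m X b = row X b"
  by (simp add: torus_graph.row_def[OF torus_subgraph] row_def edge_vec_def subgraph_def compatible_def)

lemma stress_free_subgraph:
  assumes "subgraph H G" "stress_free X"
  shows "torus_graph.stress_free H L1 L2 m X"
proof -
  have "torus_graph.row H L1 L2 m X = row X"
    by (rule ext) (rule row_subgraph[OF assms(1)])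
  moreover have "indep_family (arcs H) (row X)"
    using assms(2) subgraphE[OF assms(1)] finite_arcs unfolding stress_free_def
    by (metis indep_family_mono)
  ultimately show ?thesis
    by (simp add: torus_graph.stress_free_def[OF torus_subgraph[OF assms(1)]])
qed

end


section \<open>Counting and orientations\<close>

locale isostatic_graph = torus_graph G L1 L2 m
  for G :: "('v::finite, 'e) pre_digraph" and L1 L2 m +
  assumes isostatic: "isostatic L1 L2 m G"
begin

lemma generically_inf_rigid: "generically (configs (verts G)) inf_rigid"
  using isostaticD[OF isostatic] inf_rigid_generic by metis

lemma inf_rigid_stress_free: "inf_rigid X \<Longrightarrow> stress_free X"
  using isostaticD[OF isostatic] stress_free_iff_card by metis

lemma obtain_inf_rigid:
  obtains X where "X \<in> configs (verts G)" "inf_rigid X" "stress_free X"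
  using isostaticD[OF isostatic] by metis

text \<open>The row of a loop is zero, so unit tension on it would be a self stress.\<close>

lemma no_loop: "b \<in> arcs G \<Longrightarrow> tail G b \<noteq> head G b"
proof
  assume b: "b \<in> arcs G" "tail G b = head G b"
  obtain X where X: "inf_rigid X" "stress_free X"
    using obtain_inf_rigid by metis
  have "net_force X (\<lambda>c. if c = b then 1 else 0) = (\<Sum>c\<in>arcs G. if c = b then row X b else 0)"
    unfolding net_force_rows by (intro sum.cong) auto
  also have "\<dots> = net_force X (\<lambda>_. 0)"
    using b by (simp add: row_def net_force_rows)
  finally show False
    using stress_freeD[OF X(2) _ b(1), of "\<lambda>c. if c = b then 1 else 0" "\<lambda>_. 0"] by simp
qed

text \<open>The additive form avoids truncated subtraction in the counts below.\<close>

lemma dim_loads_subset: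
  assumes "U \<subseteq> verts G" "U \<noteq> {}"
  shows "dim (loads U) + 2 = 2 * card U"
proof -
  have "card U > 0"
    using assms by (simp add: card_gt_0_iff)
  then show ?thesis
    using dim_loads[OF assms(2)] by simp
qed

lemma card_arcs:
  assumes "verts G \<noteq> {}"
  shows "card (arcs G) + 2 = 2 * card (verts G)"
proof -
  obtain X where "inf_rigid X" "stress_free X"
    using obtain_inf_rigid by metis
  then show ?thesis
    using dim_loads_subset[of "verts G"] assms stress_free_iff_card by simp
qed

text \<open>The Maxwell count: the rows of \<open>H\<close> remain independent and lie in the loads
  on \<open>verts H\<close>.\<close>

lemma subgraph_card_le:
  assumes H: "subgraph H G" and "verts H \<noteq> {}"
  shows "card (arcs H) + 2 \<le> 2 * card (verts H)"
proof -
  interpret H: torus_graph H L1 L2 m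
    using torus_subgraph[OF H] .
  obtain X where "stress_free X"
    using obtain_inf_rigid by metis
  from H.card_arcs_le[OF stress_free_subgraph[OF H this]] show ?thesis
    using dim_loads_subset[of "verts H"] assms by (auto simp: subgraph_def)
qed

text \<open>The rows of \<open>H\<close> are independent wherever those of \<open>G\<close> are, and
  independent rows in the number of the dimension span. This makes condition (a) purely
  combinatorial.\<close>

lemma subgraph_isostatic_iff:
  assumes H: "subgraph H G" and ne: "verts H \<noteq> {}"
  shows "isostatic L1 L2 m H \<longleftrightarrow> card (arcs H) + 2 = 2 * card (verts H)"
proof -
  interpret H: torus_graph H L1 L2 m
    using torus_subgraph[OF H] .
  have dim: "dim (loads (verts H)) + 2 = 2 * card (verts H)"
    using dim_loads_subset[of "verts H"] assms by (auto simp: subgraph_def)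
  show ?thesis
  proof
    assume "isostatic L1 L2 m H"
    then show "card (arcs H) + 2 = 2 * card (verts H)"
      using H.isostaticD H.stress_free_iff_card dim by metis
  next
    assume card: "card (arcs H) + 2 = 2 * card (verts H)"
    obtain X where X: "stress_free X"
      using obtain_inf_rigid by metis
    define Y where "Y = restrict_config (verts H) X"
    have "H.stress_free Y"
      unfolding Y_def H.stress_free_restrict by (rule stress_free_subgraph[OF H X])
    moreover from this have "H.inf_rigid Y"
      by (rule H.stress_free_inf_rigid) (use dim card in simp)
    ultimately show "isostatic L1 L2 m H"
      using H.isostaticI[of Y] restrict_config_in Y_def by blast
  qed
qed

text \<open>A nonzero entry of a row lies at an endpoint of its edge. The transversal thus matches
  each edge with one of the two coordinates of an endpoint other than \<open>w\<close>; by the count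
  every such coordinate is used once. Orienting each edge towards its matched endpoint gives the
  in-degrees.\<close>

lemma orientation_exists:
  assumes w: "w \<in> verts G"
  shows "\<exists>\<rho>. \<forall>v\<in>verts G. in_degree (orient G \<rho>) v = (if v = w then 0 else 2)"
proof -
  obtain X where X: "stress_free X"
    using obtain_inf_rigid by metis
  define K where "K = (verts G - {w}) \<times> (UNIV :: 2 set)"
  have "\<exists>\<sigma>. inj_on \<sigma> (arcs G) \<and> (\<forall>b\<in>arcs G. \<sigma> b \<in> K \<and> row X b $ fst (\<sigma> b) $ snd (\<sigma> b) \<noteq> 0)"
  proof (rule indep_family_transversal[where v = "\<lambda>b p. row X b $ fst p $ snd p"])
    \<comment> \<open>Dropping the coordinates at \<open>w\<close> keeps the rows independent,
      because the force at \<open>w\<close> is minus the sum of the others.\<close>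
    fix t assume t: "\<And>k. k \<in> K \<Longrightarrow> (\<Sum>b\<in>arcs G. t b * row X b $ fst k $ snd k) = 0"
    have "net_force X t $ i $ k = 0" if "i \<in> verts G - {w}" for i k
      using t[of "(i, k)"] that by (simp add: net_force_rows K_def)
    then have z: "net_force X t $ i = 0" if "i \<in> verts G - {w}" for i
      using that by (simp add: vec_eq_iff)
    have l: "net_force X t \<in> loads (verts G)"
      by (rule net_force_in_loads)
    have "net_force X t $ w = (\<Sum>i\<in>verts G. net_force X t $ i)"
      using w z by (simp add: sum.remove)
    then have "net_force X t $ i = 0" for i
      using z[of i] l by (cases "i = w"; cases "i \<in> verts G") (auto simp: loads_def configs_def)
    then have "net_force X t = net_force X (\<lambda>_. 0)"
      by (simp add: vec_eq_iff net_force_rows)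
    then show "\<forall>b\<in>arcs G. t b = 0"
      using stress_freeD[OF X] by blast
  qed (auto simp: K_def)
  then obtain \<sigma> where inj: "inj_on \<sigma> (arcs G)" and \<sigma>: "\<And>b. b \<in> arcs G \<Longrightarrow> \<sigma> b \<in> K"
      "\<And>b. b \<in> arcs G \<Longrightarrow> row X b $ fst (\<sigma> b) $ snd (\<sigma> b) \<noteq> 0"
    by blast
  have ends: "fst (\<sigma> b) = head G b \<or> fst (\<sigma> b) = tail G b" if "b \<in> arcs G" for b
    using \<sigma>(2)[OF that] by (auto simp: row_def axis_def split: if_splits)
  have "verts G \<noteq> {}" "card (verts G) > 0"
    using w by (auto simp: card_gt_0_iff)
  then have "card K = card (arcs G)"
    using w card_arcs by (simp add: K_def card_cartesian_product)
  then have onto: "\<sigma> ` arcs G = K"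
    using image_subsetI[of "arcs G" \<sigma> K, OF \<sigma>(1)] inj
    by (intro card_subset_eq) (simp_all add: card_image K_def)
  define \<rho> where "\<rho> b \<longleftrightarrow> fst (\<sigma> b) = head G b" for b
  have "in_arcs (orient G \<rho>) v = {b \<in> arcs G. fst (\<sigma> b) = v}" for v
    unfolding in_arcs_def
    by (rule Collect_cong) (use ends in \<open>force simp: orient_def \<rho>_def\<close>)
  moreover have "card {b \<in> arcs G. fst (\<sigma> b) = v} = (if v = w then 0 else 2)"
    if "v \<in> verts G" for v
  proof -
    have "card {b \<in> arcs G. fst (\<sigma> b) = v} = card (\<sigma> ` {b \<in> arcs G. fst (\<sigma> b) = v})"
      by (rule card_image[symmetric], rule inj_on_subset[OF inj]) auto
    also have "\<sigma> ` {b \<in> arcs G. fst (\<sigma> b) = v} = {p \<in> K. fst p = v}"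
      using onto by auto
    also have "\<dots> = (if v = w then {} else {v} \<times> UNIV)"
      using that by (auto simp: K_def)
    finally show ?thesis by (simp add: card_cartesian_product)
  qed
  ultimately show ?thesis
    by (intro exI[of _ \<rho>]) (simp add: in_degree_def)
qed

text \<open>The number of vertices and the number of edges determine each other in both graphs, so
  \<open>H\<close> is proper in both. A positive number of edges forces at least two
  vertices.\<close>

lemma proper_verts:
  assumes H: "subgraph H G" "isostatic L1 L2 m H" "arcs H \<noteq> {}" "H \<noteq> G"
  shows "verts H \<subset> verts G" "card (verts H) \<ge> 2" "arcs H \<subset> arcs G"
proof -
  have ne: "verts H \<noteq> {}" "verts G \<noteq> {}"
    using H(1,3) by (auto simp: subgraph_def dest: wf_digraph.head_in_verts)
  have cH: "card (arcs H) + 2 = 2 * card (verts H)"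
    using H subgraph_isostatic_iff ne by blast
  have sub: "verts H \<subseteq> verts G" "arcs H \<subseteq> arcs G" "tail H = tail G" "head H = head G"
    using H(1) by (auto simp: subgraph_def compatible_def)
  have "card (verts H) = card (verts G) \<longleftrightarrow> card (arcs H) = card (arcs G)"
    using cH card_arcs[OF ne(2)] by auto
  then have "verts H = verts G \<longleftrightarrow> arcs H = arcs G"
    using sub by (metis card_subset_eq finite_arcs finite_verts)
  moreover have "\<not> (verts H = verts G \<and> arcs H = arcs G)"
    using H(4) sub by auto
  ultimately show "verts H \<subset> verts G" "arcs H \<subset> arcs G"
    using sub by blast+
  have "card (arcs H) > 0"
    using H(3) sub(2) finite_subset[OF _ finite_arcs] by (simp add: card_gt_0_iff)
  then show "card (verts H) \<ge> 2"
    using cH by simp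
qed

lemma card_in_arcs_UN:
  assumes "B \<subseteq> verts G" "\<And>x. x \<in> B \<Longrightarrow> in_degree (orient G \<rho>) x = 2"
  shows "card (\<Union>x\<in>B. in_arcs (orient G \<rho>) x) = 2 * card B"
proof -
  have "finite (in_arcs (orient G \<rho>) x)" for x
    by (rule finite_subset[OF _ finite_arcs]) (auto simp: in_arcs_def orient_def)
  then have "card (\<Union>x\<in>B. in_arcs (orient G \<rho>) x) = (\<Sum>x\<in>B. in_degree (orient G \<rho>) x)"
    unfolding in_degree_def using assms(1)
    by (intro card_UN_disjoint) (auto intro: finite_subset simp: in_arcs_def)
  then show ?thesis
    using assms(2) by simp
qed

lemma wf_orient: "wf_digraph (orient G \<rho>)"
  by unfold_locales (auto simp: orient_def)

text \<open>A set \<open>B\<close> of vertices other than \<open>w\<close>, entered by arcs from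
  \<open>B\<close> and \<open>w\<close> only, collects \<open>2 * card B\<close> edges inside
  \<open>insert w B\<close>. This is exactly the isostatic count on \<open>card B + 1\<close>
  vertices, so failures of strong connectivity correspond to isostatic subgraphs containing
  \<open>w\<close>.\<close>

lemma strongly_connected_orientations_iff:
  "no_proper_isostatic_subgraph L1 L2 m G \<longleftrightarrow> orientations_strongly_connected G"
proof
  assume a: "no_proper_isostatic_subgraph L1 L2 m G"
  show "orientations_strongly_connected G"
    unfolding orientations_strongly_connected_def Let_def
  proof (intro allI ballI impI, rule ccontr)
    fix \<rho> w
    assume w: "w \<in> verts G" "{v \<in> verts G. in_degree (orient G \<rho>) v \<noteq> 2} = {w}"
    define D where "D = orient G \<rho> \<restriction> (verts G - {w})"
    interpret D: wf_digraph D
      unfolding D_def using wf_orient by (rule wf_digraph.wellformed_induce_subgraph)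
    assume "\<not> (verts (orient G \<rho> \<restriction> (verts G - {w})) = {} \<or>
      strongly_connected (orient G \<rho> \<restriction> (verts G - {w})))"
    then obtain u v where uv: "u \<in> verts G - {w}" "v \<in> verts G - {w}" "\<not> u \<rightarrow>\<^sup>*\<^bsub>D\<^esub> v"
      by (auto simp: strongly_connected_def D_def)
    \<comment> \<open>The vertices that \<open>u\<close> cannot reach: an arc into \<open>B\<close>
      from outside \<open>insert w B\<close> would make its head reachable.\<close>
    define B where "B = {x \<in> verts G - {w}. \<not> u \<rightarrow>\<^sup>*\<^bsub>D\<^esub> x}"
    define H where "H = G \<restriction> (insert w B)"
    have "u \<rightarrow>\<^sup>*\<^bsub>D\<^esub> u"
      using uv by (intro D.reachable_refl) (simp add: D_def)
    then have B: "B \<subseteq> verts G" "w \<notin> B" "v \<in> B" "u \<notin> B"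
      using uv by (auto simp: B_def)
    have H: "subgraph H G"
      unfolding H_def using w B by (intro induced_imp_subgraph induced_induce) auto
    have in_arcs: "b \<in> arcs H" if "x \<in> B" "b \<in> in_arcs (orient G \<rho>) x" for b x
    proof -
      have b: "b \<in> arcs G" "head (orient G \<rho>) b = x"
        using that by (auto simp: in_arcs_def orient_def)
      define y where "y = tail (orient G \<rho>) b"
      have y: "y \<in> verts G"
        using b(1) by (auto simp: y_def orient_def)
      have "y \<in> insert w B"
      proof (rule ccontr)
        assume n: "y \<notin> insert w B"
        then have "u \<rightarrow>\<^sup>*\<^bsub>D\<^esub> y"
          using y by (auto simp: B_def)
        moreover have "b \<in> arcs D"
          using b n y that(1) B by (auto simp: D_def y_def orient_def)
        then have "y \<rightarrow>\<^bsub>D\<^esub> x"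
          using D.in_arcs_imp_in_arcs_ends[of b] b by (simp add: D_def y_def)
        ultimately have "u \<rightarrow>\<^sup>*\<^bsub>D\<^esub> x"
          by (rule D.reachable_adj_trans)
        then show False using that(1) by (simp add: B_def)
      qed
      then have "head G b \<in> insert w B \<and> tail G b \<in> insert w B"
        using b(2) that(1) by (cases "\<rho> b") (simp_all add: y_def orient_def)
      then show ?thesis
        using b(1) by (simp add: H_def)
    qed
    have finB: "finite B"
      by simp
    have deg: "in_degree (orient G \<rho>) x = 2" if "x \<in> B" for x
    proof (rule ccontr)
      assume "in_degree (orient G \<rho>) x \<noteq> 2"
      then have "x \<in> {v \<in> verts G. in_degree (orient G \<rho>) v \<noteq> 2}"
        using B(1) that by auto
      then show False
        using w(2) B(2) that by simp
    qed
    have "finite (arcs H)"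
      by (rule finite_subset[OF _ finite_arcs]) (simp add: H_def)
    have "2 * card B = card (\<Union>x\<in>B. in_arcs (orient G \<rho>) x)"
      using B(1) deg by (rule card_in_arcs_UN[symmetric])
    also have "\<dots> \<le> card (arcs H)"
      by (rule card_mono[OF \<open>finite (arcs H)\<close>]) (use in_arcs in blast)
    finally have le: "2 * card B \<le> card (arcs H)" .
    moreover have "card B > 0"
      using B(3) finB by (auto simp: card_gt_0_iff)
    moreover have "card (verts H) = Suc (card B)"
      using B(2) finB by (simp add: H_def)
    ultimately have "card (arcs H) + 2 \<ge> 2 * card (verts H)" "card (arcs H) > 0"
      by simp_all
    moreover have "verts H \<noteq> {}" by (simp add: H_def)
    ultimately have "card (arcs H) + 2 = 2 * card (verts H)" "arcs H \<noteq> {}" "verts H \<noteq> {}"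
      using subgraph_card_le[OF H] by auto
    moreover have "u \<notin> verts H"
      using uv(1) B(4) by (simp add: H_def)
    then have "H \<noteq> G"
      using uv(1) by blast
    ultimately show False
      using a H subgraph_isostatic_iff unfolding no_proper_isostatic_subgraph_def by blast
  qed
next
  assume b: "orientations_strongly_connected G"
  show "no_proper_isostatic_subgraph L1 L2 m G"
    unfolding no_proper_isostatic_subgraph_def
  proof (intro notI, elim exE conjE)
    fix H assume H: "subgraph H G" "H \<noteq> G" "arcs H \<noteq> {}" "isostatic L1 L2 m H"
    note proper = proper_verts[OF H(1,4,3,2)]
    have ne: "verts H \<noteq> {}"
      using proper(2) by auto
    then obtain w where w: "w \<in> verts H" by blast
    then have wG: "w \<in> verts G" using proper(1) by blast
    then obtain \<rho> where \<rho>: "\<And>v. v \<in> verts G \<Longrightarrow> in_degree (orient G \<rho>) v = (if v = w then 0 else 2)"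
      using orientation_exists by blast
    define D where "D = orient G \<rho> \<restriction> (verts G - {w})"
    interpret D: wf_digraph D
      unfolding D_def using wf_orient by (rule wf_digraph.wellformed_induce_subgraph)
    obtain x where x: "x \<in> verts G" "x \<notin> verts H"
      using proper(1) by blast
    have "card (verts H - {w}) \<noteq> 0"
      using proper(2) w by simp
    then obtain y where y: "y \<in> verts H" "y \<noteq> w"
      by (metis Diff_iff card.empty insertCI ex_in_conv)
    have "{v \<in> verts G. in_degree (orient G \<rho>) v \<noteq> 2} = {w}"
      using \<rho> wG by (auto split: if_splits)
    then have "strongly_connected D"
      using b wG x w unfolding orientations_strongly_connected_def Let_def D_def by fastforce
    then have "x \<rightarrow>\<^sup>*\<^bsub>D\<^esub> y"
      using x y w proper(1) by (auto simp: strongly_connected_def D_def)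
    define B where "B = verts H - {w}"
    have B: "B \<subseteq> verts G" "finite B"
      using proper(1) by (auto simp: B_def)
    have HE: "head H = head G" "tail H = tail G" "wf_digraph H"
      using H(1) by (auto simp: subgraph_def compatible_def)
    have w0: "in_arcs (orient G \<rho>) w = {}"
    proof -
      have "finite (in_arcs (orient G \<rho>) w)"
        by (rule finite_subset[OF _ finite_arcs]) (auto simp: in_arcs_def orient_def)
      then show ?thesis
        using \<rho>[OF wG] by (simp add: in_degree_def)
    qed
    have "arcs H \<subseteq> (\<Union>x\<in>B. in_arcs (orient G \<rho>) x)"
    proof
      fix e assume e: "e \<in> arcs H"
      then have eG: "e \<in> arcs G" using proper(3) by blast
      have "head (orient G \<rho>) e \<in> verts H"
        using e HE wf_digraph.head_in_verts[OF HE(3) e] wf_digraph.tail_in_verts[OF HE(3) e]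
        by (simp add: orient_def)
      moreover have "head (orient G \<rho>) e \<noteq> w"
        using w0 eG by (auto simp: in_arcs_def orient_def)
      ultimately show "e \<in> (\<Union>x\<in>B. in_arcs (orient G \<rho>) x)"
        using eG by (auto simp: B_def in_arcs_def orient_def)
    qed
    moreover have "card (\<Union>x\<in>B. in_arcs (orient G \<rho>) x) = 2 * card B"
      using B \<rho> by (intro card_in_arcs_UN) (auto simp: B_def)
    moreover have "2 * card B = card (arcs H)"
      using subgraph_isostatic_iff[OF H(1) ne] H(4) w B by (simp add: B_def)
    moreover have "finite (\<Union>x\<in>B. in_arcs (orient G \<rho>) x)"
      by (rule finite_subset[OF _ finite_arcs]) (auto simp: in_arcs_def orient_def)
    \<comment> \<open>Both sides have \<open>2 * card B\<close> elements, so every arc entering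
      \<open>B\<close> belongs to \<open>H\<close>, and no path avoiding \<open>w\<close> leads into
      \<open>H\<close> from outside.\<close>
    ultimately have eq: "arcs H = (\<Union>x\<in>B. in_arcs (orient G \<rho>) x)"
      by (intro card_subset_eq) auto
    have "y \<notin> verts H"
      using \<open>x \<rightarrow>\<^sup>*\<^bsub>D\<^esub> y\<close>
    proof (induction rule: D.reachable_induct)
      case base
      show ?case using x by simp
    next
      case (step p q)
      then obtain e where e: "e \<in> arcs D" "tail D e = p" "head D e = q"
        by auto
      show ?case
      proof
        assume "q \<in> verts H"
        then have "e \<in> arcs H"
          unfolding eq using e by (auto simp: B_def D_def in_arcs_def orient_def)
        then have "p \<in> verts H"
          using e HE wf_digraph.head_in_verts[OF HE(3)] wf_digraph.tail_in_verts[OF HE(3)]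
          by (auto simp: D_def orient_def split: if_splits)
        with step show False by blast
      qed
    qed
    with y show False by blast
  qed
qed

end


section \<open>Stresses and zero modes in the plane\<close>

definition rot :: "real^2 \<Rightarrow> real^2" where
  "rot x = (\<chi> k. if k = 1 then - x $ 2 else x $ 1)"

lemma rot_nth [simp]: "rot x $ 1 = - x $ 2" "rot x $ 2 = x $ 1"
  by (simp_all add: rot_def)

lemma rot_add: "rot (x + y) = rot x + rot y"
  by (simp add: vec_eq_iff forall_2)

lemma rot_diff: "rot (x - y) = rot x - rot y"
  by (simp add: vec_eq_iff forall_2)

lemma rot_inner_rot: "rot x \<bullet> rot y = x \<bullet> y"
  by (simp add: inner_vec_def sum_2)

lemma inner_rot_self: "x \<bullet> rot x = 0"
  by (simp add: inner_vec_def sum_2)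

lemma rot_eq_0_iff [simp]: "rot x = 0 \<longleftrightarrow> x = 0"
  by (auto simp: vec_eq_iff forall_2)

text \<open>This is where the dimension two enters: a relative velocity that does not stretch an
  edge is a rotation at some rate, here the determinant of \<open>d\<close> and \<open>w\<close>
  divided by the squared length \<open>q\<close> of \<open>d\<close>.\<close>

lemma orthogonal_imp_rot:
  assumes "d \<noteq> 0" "d \<bullet> w = 0"
  shows "\<exists>c. w = c *\<^sub>R rot d"
proof
  define q where "q = d $ 1 * d $ 1 + d $ 2 * d $ 2"
  have q: "q \<noteq> 0"
    using assms(1) by (auto simp: q_def vec_eq_iff forall_2 sum_squares_eq_zero_iff)
  have o: "d $ 1 * w $ 1 + d $ 2 * w $ 2 = 0"
    using assms(2) by (simp add: inner_vec_def sum_2)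
  have "q * w $ 1 = (d $ 1 * w $ 2 - d $ 2 * w $ 1) * - d $ 2"
    "q * w $ 2 = (d $ 1 * w $ 2 - d $ 2 * w $ 1) * d $ 1"
    using o unfolding q_def by algebra+
  then show "w = ((d $ 1 * w $ 2 - d $ 2 * w $ 1) / q) *\<^sub>R rot d"
    using q by (simp add: vec_eq_iff forall_2 field_simps)
qed

lemma polynomial_function_axis:
  fixes F :: "'p::euclidean_space \<Rightarrow> real^2"
  assumes "polynomial_function F"
  shows "polynomial_function (\<lambda>p. axis i (F p) :: real^2^'v::finite)"
  unfolding polynomial_function_vec2
proof (intro allI)
  fix j k
  show "real_polynomial_function (\<lambda>p. axis i (F p) $ j $ k)"
    using real_polynomial_function_vec_nth[OF assms, of k]
    by (cases "j = i") (auto simp: axis_def)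
qed

text \<open>
  The vector \<open>link i j g X\<close> is the edge vector of a further edge from \<open>i\<close> to \<open>j\<close> with an arbitrary real
  gain vector \<open>g\<close>; together with the tension \<open>1\<close> on that edge, \<open>link_response i j g X\<close> is a self
  stress.
\<close>

definition couple :: "'v::finite \<Rightarrow> 'v \<Rightarrow> real^2 \<Rightarrow> real^2^'v" where
  "couple i j y = axis i y - axis j y"

definition link :: "'v::finite \<Rightarrow> 'v \<Rightarrow> real^2 \<Rightarrow> real^2^'v \<Rightarrow> real^2" where
  "link i j g X = X $ j + g - X $ i"

text \<open>For \<open>i = j\<close> the two differ: \<open>couple\<close> then vanishes, so that it
  is always a load and linear in the force.\<close>

lemma couple_eq_force_pair: "i \<noteq> j \<Longrightarrow> force_pair i j y = couple i j y"
  by (auto simp: force_pair_def couple_def vec_eq_iff axis_def)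

lemma couple_inner: "couple i j y \<bullet> u = y \<bullet> (u $ i - u $ j)"
  by (simp add: couple_def inner_diff_left inner_diff_right inner_axis')

lemma couple_in_loads: "\<lbrakk>i \<in> V; j \<in> V\<rbrakk> \<Longrightarrow> couple i j y \<in> loads V"
  unfolding couple_def by (rule axis_diff_in_loads)

lemma polynomial_couple:
  fixes F :: "'p::euclidean_space \<Rightarrow> real^2"
  shows "polynomial_function F \<Longrightarrow> polynomial_function (\<lambda>p. couple i j (F p))"
  unfolding couple_def by (intro polynomial_function_diff polynomial_function_axis)

lemma polynomial_link: "polynomial_function (link i j g)"
  unfolding link_def[abs_def]
  by (intro polynomial_function_diff polynomial_function_add polynomial_function_vec_nth
      polynomial_function_const polynomial_function_id[unfolded id_def])

context torus_graph
begin

text \<open>A tension times \<open>stiffness_det\<close> is a polynomial, so one rigid point with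
  nonzero tension suffices. The implication guards the points that are not rigid, where
  \<open>response\<close> has no meaning.\<close>

lemma generically_response_nonzero:
  fixes X F :: "'p::euclidean_space \<Rightarrow> real^2^'v"
  assumes X: "polynomial_function X" and F: "polynomial_function F"
    and p: "p \<in> W" "inf_rigid (X p)" "response (X p) (F p) b \<noteq> 0"
  shows "generically W (\<lambda>p. inf_rigid (X p) \<longrightarrow> response (X p) (F p) b \<noteq> 0)"
proof -
  obtain N where N: "real_polynomial_function N"
      "\<And>p. inf_rigid (X p) \<Longrightarrow> response (X p) (F p) b * stiffness_det (X p) = N p"
    using polynomial_response[OF X F] by blast
  have "N p \<noteq> 0"
    using N(2)[OF p(2)] p by (metis mult_eq_0_iff stiffness_det_nonzero)
  from generically_nonzero[OF N(1) p(1) this] show ?thesis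
    by (rule generically_mono) (use N(2) in force)
qed

definition link_response :: "'v \<Rightarrow> 'v \<Rightarrow> real^2 \<Rightarrow> real^2^'v \<Rightarrow> 'e \<Rightarrow> real" where
  "link_response i j g X = response X (couple i j (link i j g X))"

text \<open>The principle of virtual work. For a motion of the support of the tensions the left side
  vanishes, which restricts how \<open>i\<close> and \<open>j\<close> move relative to each
  other.\<close>

lemma response_work:
  assumes "inf_rigid X" "i \<in> verts G" "j \<in> verts G"
  shows "(\<Sum>c\<in>arcs G. response X (couple i j y) c * strain X u c) = y \<bullet> (u $ i - u $ j)"
  using net_force_inner[of X "response X (couple i j y)" u] assms
  by (simp add: net_force_response couple_in_loads couple_inner)

end

context isostatic_graph
begin

lemma dvec_nonzero:
  assumes X: "inf_rigid X" and b: "b \<in> arcs G"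
  shows "dvec X b \<noteq> 0"
proof
  assume "dvec X b = 0"
  have "net_force X (\<lambda>c. if c = b then 1 else 0) = (\<Sum>c\<in>arcs G. if c = b then row X b else 0)"
    unfolding net_force_rows by (intro sum.cong) auto
  also have "\<dots> = net_force X (\<lambda>_. 0)"
    using b \<open>dvec X b = 0\<close> by (simp add: row_def net_force_rows axis_def vec_eq_iff)
  finally show False
    using stress_freeD[OF inf_rigid_stress_free[OF X] _ b,
        of "\<lambda>c. if c = b then 1 else 0" "\<lambda>_. 0"] by simp
qed

text \<open>
  The self stress is orthogonal to all strains at every configuration. Along a line of configurations
  the strains of \<open>u\<close> on the support of the stress grow linearly from \<open>0\<close>, which gives the identity in
  the limit.
\<close>

lemma stress_motion_identity:
  assumes ij: "i \<in> verts G" "j \<in> verts G"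
    and X0: "X0 \<in> configs (verts G)" "inf_rigid X0"
    and supp: "\<And>X c. \<lbrakk>X \<in> configs (verts G); inf_rigid X; c \<in> arcs G - S\<rbrakk> \<Longrightarrow>
                 link_response i j g X c = 0"
    and u: "\<And>c. c \<in> S \<Longrightarrow> strain X0 u c = 0" "link i j g X0 \<bullet> (u $ j - u $ i) = 0"
    and v: "v \<in> configs (verts G)"
  shows "(\<Sum>c\<in>arcs G. link_response i j g X0 c *
           ((v $ head G c - v $ tail G c) \<bullet> (u $ head G c - u $ tail G c)))
         + (v $ j - v $ i) \<bullet> (u $ j - u $ i) = 0"
proof -
  define \<delta> where "\<delta> c = (v $ head G c - v $ tail G c) \<bullet> (u $ head G c - u $ tail G c)" for c
  define \<epsilon> where "\<epsilon> = (v $ j - v $ i) \<bullet> (u $ j - u $ i)"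
  have "\<exists>N. real_polynomial_function N \<and>
      (\<forall>X. inf_rigid X \<longrightarrow> link_response i j g X c * stiffness_det X = N X)" for c
    using polynomial_response[OF polynomial_function_id[unfolded id_def]
        polynomial_couple[OF polynomial_link]]
    unfolding link_response_def by metis
  then obtain N where N: "\<And>c. real_polynomial_function (N c)"
      "\<And>c X. inf_rigid X \<Longrightarrow> link_response i j g X c * stiffness_det X = N c X"
    by metis
  \<comment> \<open>The claimed expression times \<open>stiffness_det\<close>, with
    \<open>\<delta>\<close> and \<open>\<epsilon>\<close> fixed: a polynomial in the configuration,
    whose zeros on the punctured line reach \<open>X0\<close>.\<close>
  define P where "P X = (\<Sum>c\<in>arcs G. N c X * \<delta> c) + stiffness_det X * \<epsilon>" for X
  have P: "real_polynomial_function P"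
    unfolding P_def
    by (intro real_polynomial_function.intros(2-4) real_polynomial_function_sum N finite_arcs
        polynomial_stiffness_det)
  have P_eq: "P X = ((\<Sum>c\<in>arcs G. link_response i j g X c * \<delta> c) + \<epsilon>) * stiffness_det X"
    if "inf_rigid X" for X
    by (simp add: P_def N(2)[OF that, symmetric] sum_distrib_left sum_distrib_right algebra_simps)
  have zero: "P (X0 + e *\<^sub>R v) = 0" if e: "e \<noteq> 0" "stiffness_det (X0 + e *\<^sub>R v) \<noteq> 0" for e
  proof -
    define X where "X = X0 + e *\<^sub>R v"
    have rig: "inf_rigid X"
      using e(2) by (simp add: X_def stiffness_det_nonzero)
    have X: "X \<in> configs (verts G)"
      unfolding X_def using X0(1) v by (intro subspace_add subspace_scale subspace_configs)
    have eq: "link_response i j g X c * strain X u c = e * (link_response i j g X c * \<delta> c)"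
      if c: "c \<in> arcs G" for c
    proof (cases "c \<in> S")
      case True
      \<comment> \<open>The strain is affine in the configuration and starts at zero on
        \<open>S\<close>. Off \<open>S\<close> the strain is uncontrolled, but there the tension is
        zero at every rigid configuration.\<close>
      have "strain X u c = strain X0 u c + e * \<delta> c"
        by (simp add: compat_def edge_vec_def X_def \<delta>_def inner_add_left inner_diff_left algebra_simps)
      then show ?thesis using u(1)[OF True] by simp
    next
      case False
      then show ?thesis using supp[OF X rig, of c] c by simp
    qed
    have "e * (\<Sum>c\<in>arcs G. link_response i j g X c * \<delta> c) =
        (\<Sum>c\<in>arcs G. link_response i j g X c * strain X u c)"
      unfolding sum_distrib_left by (rule sum.cong[OF refl]) (simp only: eq)
    also have "\<dots> = link i j g X \<bullet> (u $ i - u $ j)"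
      unfolding link_response_def by (rule response_work[OF rig ij])
    also have "\<dots> = - e * \<epsilon>"
    proof -
      have "link i j g X = link i j g X0 + e *\<^sub>R (v $ j - v $ i)"
        by (simp add: link_def X_def algebra_simps)
      moreover have "u $ i - u $ j = - (u $ j - u $ i)" by simp
      ultimately show ?thesis
        using u(2) by (simp only: inner_add_left inner_minus_right \<epsilon>_def inner_scaleR_left)
    qed
    finally have "e * ((\<Sum>c\<in>arcs G. link_response i j g X c * \<delta> c) + \<epsilon>) = 0"
      by (simp add: distrib_left)
    then have "(\<Sum>c\<in>arcs G. link_response i j g X c * \<delta> c) + \<epsilon> = 0"
      using e(1) by (simp only: mult_eq_0_iff simp_thms)
    then show ?thesis
      using P_eq[OF rig] by (simp add: X_def)
  qed
  have "P X0 = 0"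
  proof (rule ccontr)
    assume "P X0 \<noteq> 0"
    then have "finite {e. P (X0 + e *\<^sub>R v) = 0}"
      by (intro real_polynomial_line[OF P, where c = 0]) simp
    moreover have "finite {e. stiffness_det (X0 + e *\<^sub>R v) = 0}"
      using X0(2) by (intro real_polynomial_line[OF polynomial_stiffness_det, where c = 0])
        (simp add: stiffness_det_nonzero)
    moreover have "UNIV = {0} \<union> {e. P (X0 + e *\<^sub>R v) = 0} \<union> {e. stiffness_det (X0 + e *\<^sub>R v) = 0}"
      using zero by blast
    ultimately have "finite (UNIV :: real set)"
      by (metis finite.emptyI finite.insertI finite_UnI)
    then show False
      using infinite_UNIV_char_0 by blast
  qed
  moreover have "stiffness_det X0 \<noteq> 0"
    using X0(2) by (simp add: stiffness_det_nonzero)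
  ultimately show ?thesis
    using P_eq[OF X0(2)] by (simp add: \<delta>_def \<epsilon>_def)
qed

text \<open>
  In the plane \<open>u\<close> rotates each edge of the support at a rate \<open>\<lambda>\<^sub>c\<close>. By the identity above,
  multiplying the stress by these rates gives another self stress, so that all rates agree.
\<close>

lemma common_rotation_rate:
  assumes ij: "i \<in> verts G" "j \<in> verts G"
    and X0: "X0 \<in> configs (verts G)" "inf_rigid X0" "link i j g X0 \<noteq> 0"
    and supp: "\<And>X c. \<lbrakk>X \<in> configs (verts G); inf_rigid X; c \<in> arcs G - S\<rbrakk> \<Longrightarrow>
                 link_response i j g X c = 0"
    and S: "S \<subseteq> arcs G" "\<And>c. c \<in> S \<Longrightarrow> link_response i j g X0 c \<noteq> 0"
    and u: "\<And>c. c \<in> S \<Longrightarrow> strain X0 u c = 0"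
  obtains r where "u $ j - u $ i = r *\<^sub>R rot (link i j g X0)"
    and "\<And>c. c \<in> S \<Longrightarrow> u $ head G c - u $ tail G c = r *\<^sub>R rot (dvec X0 c)"
proof -
  define t where "t = link_response i j g X0"
  have t0: "t c = 0" if "c \<in> arcs G - S" for c
    using supp[OF X0(1,2) that] by (simp add: t_def)
  \<comment> \<open>By virtual work, a motion that strains no stressed edge cannot stretch the link
    either.\<close>
  have ue: "link i j g X0 \<bullet> (u $ j - u $ i) = 0"
  proof -
    have "(\<Sum>c\<in>arcs G. t c * strain X0 u c) = 0"
      using t0 u by (intro sum.neutral) auto
    then have "link i j g X0 \<bullet> (u $ i - u $ j) = 0"
      using response_work[OF X0(2) ij, of "link i j g X0" u] by (simp add: t_def link_response_def)
    then show ?thesis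
      by (simp add: inner_diff_right)
  qed
  obtain r where r: "u $ j - u $ i = r *\<^sub>R rot (link i j g X0)"
    using orthogonal_imp_rot[OF X0(3) ue] by blast
  have "\<exists>l. c \<in> S \<longrightarrow> u $ head G c - u $ tail G c = l *\<^sub>R rot (dvec X0 c)" for c
    using orthogonal_imp_rot[OF dvec_nonzero[OF X0(2)], of c "u $ head G c - u $ tail G c"] u[of c] S(1)
    by (auto simp: compat_def)
  then obtain l where l: "\<And>c. c \<in> S \<Longrightarrow> u $ head G c - u $ tail G c = l c *\<^sub>R rot (dvec X0 c)"
    by metis
  define D where "D = net_force X0 (\<lambda>c. t c * l c) - net_force X0 (\<lambda>c. r * t c)"
  have D: "D \<in> configs (verts G)"
    unfolding D_def using net_force_in_loads
    by (intro subspace_diff subspace_configs) (auto simp: loads_def)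
  \<comment> \<open>Since \<open>rot\<close> preserves inner products, this direction turns the
    products with \<open>rot (dvec X0 c)\<close> into strains of \<open>D\<close>. The identity then
    reads \<open>D \<bullet> D = 0\<close>.\<close>
  define v where "v = (\<chi> k. rot (D $ k))"
  have v: "v \<in> configs (verts G)"
    using D by (auto simp: v_def configs_def)
  have vd: "v $ a - v $ b = rot (D $ a - D $ b)" for a b
    by (simp add: v_def rot_diff)
  have "0 = (\<Sum>c\<in>arcs G. t c * ((v $ head G c - v $ tail G c) \<bullet> (u $ head G c - u $ tail G c)))
      + (v $ j - v $ i) \<bullet> (u $ j - u $ i)"
    unfolding t_def by (rule stress_motion_identity[OF ij X0(1,2) supp u ue v, symmetric])
  also have "(\<Sum>c\<in>arcs G. t c * ((v $ head G c - v $ tail G c) \<bullet> (u $ head G c - u $ tail G c)))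
      = (\<Sum>c\<in>arcs G. t c * l c * strain X0 D c)"
  proof (rule sum.cong)
    fix c assume "c \<in> arcs G"
    then show "t c * ((v $ head G c - v $ tail G c) \<bullet> (u $ head G c - u $ tail G c))
        = t c * l c * strain X0 D c"
      using t0[of c] l[of c]
      by (cases "c \<in> S") (simp_all add: vd rot_inner_rot compat_def inner_commute)
  qed simp
  also have "\<dots> = net_force X0 (\<lambda>c. t c * l c) \<bullet> D"
    by (simp add: net_force_inner)
  also have "(v $ j - v $ i) \<bullet> (u $ j - u $ i) = - (r * (link i j g X0 \<bullet> (D $ i - D $ j)))"
    unfolding r vd by (simp add: rot_inner_rot inner_commute inner_diff_right algebra_simps)
  also have "link i j g X0 \<bullet> (D $ i - D $ j) = net_force X0 t \<bullet> D"
    unfolding net_force_inner t_def link_response_def by (rule response_work[OF X0(2) ij, symmetric])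
  also have "r * (net_force X0 t \<bullet> D) = net_force X0 (\<lambda>c. r * t c) \<bullet> D"
    by (simp add: net_force_inner sum_distrib_left mult.assoc)
  finally have "D \<bullet> D = 0"
    by (simp add: D_def inner_diff_left)
  then have "net_force X0 (\<lambda>c. t c * l c) = net_force X0 (\<lambda>c. r * t c)"
    by (simp add: D_def)
  from stress_freeD[OF inf_rigid_stress_free[OF X0(2)] this]
  have tl: "t c * l c = r * t c" if "c \<in> S" for c
    using S(1) that by blast
  have "l c = r" if "c \<in> S" for c
    using S(2)[OF that] tl[OF that] by (simp add: t_def)
  then have "u $ head G c - u $ tail G c = r *\<^sub>R rot (dvec X0 c)" if "c \<in> S" for c
    using l[OF that] that by simp
  with r show thesis
    by (rule that)
qed

text \<open>
  No edge of the support joins a vertex moving like \<open>i\<close> to one moving differently, so the stress on the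
  edges among the latter is a self stress of \<open>G\<close>, hence zero.
\<close>

lemma isostatic_support:
  assumes ij: "i \<in> verts G" "j \<in> verts G" "i \<noteq> j" and X0: "inf_rigid X0"
    and t: "net_force X0 t = couple i j y" "y \<noteq> 0"
    and S: "S = {c \<in> arcs G. t c \<noteq> 0}"
    and motion: "\<And>u. (\<And>c. c \<in> S \<Longrightarrow> strain X0 u c = 0) \<Longrightarrow>
                   u $ i = u $ j \<and> (\<forall>c\<in>S. u $ head G c = u $ tail G c)"
  shows "\<exists>H. subgraph H G \<and> arcs H = S \<and> arcs H \<noteq> {} \<and> isostatic L1 L2 m H"
proof -
  define H where "H = \<lparr>verts = {i, j} \<union> head G ` S \<union> tail G ` S, arcs = S, tail = tail G, head = head G\<rparr>"
  have SG: "S \<subseteq> arcs G" using S by auto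
  have H: "subgraph H G"
  proof (rule subgraphI)
    show "wf_digraph H"
      by unfold_locales (auto simp: H_def)
    show "wf_digraph G" ..
  qed (use ij SG in \<open>auto simp: H_def compatible_def\<close>)
  interpret H: torus_graph H L1 L2 m
    using torus_subgraph[OF H] .
  have ne: "S \<noteq> {}"
  proof
    assume "S = {}"
    then have "couple i j y = 0"
      unfolding t(1)[symmetric] net_force_rows using S by (intro sum.neutral) auto
    then have "couple i j y $ i = 0" by simp
    with ij(3) t(2) show False
      by (simp add: couple_def axis_def)
  qed
  have strain: "H.strain = strain"
    by (intro ext) (simp add: H_def compat_def edge_vec_def)
  have "H.inf_rigid X0"
    unfolding H.inf_rigid_def
  proof
    fix u assume u: "u \<in> zero_modes L1 L2 m H X0"
    then have "\<forall>c\<in>arcs H. H.strain X0 u c = 0"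
      by (simp add: zero_modes_def)
    then have "strain X0 u c = 0" if "c \<in> S" for c
      using that unfolding strain by (simp add: H_def)
    from motion[OF this] have uij: "u $ i = u $ j"
      and uS: "\<And>c. c \<in> S \<Longrightarrow> u $ head G c = u $ tail G c"
      by auto
    define t' where "t' c = (if u $ head G c = u $ i then 0 else t c)" for c
    \<comment> \<open>At each vertex the tensions \<open>t'\<close> either do not act or agree with
      \<open>t\<close>, as no edge of \<open>S\<close> joins the two classes. The load of
      \<open>t\<close> sits only at \<open>i\<close> and \<open>j\<close>, both in the class of
      \<open>i\<close>.\<close>
    have "net_force X0 t' $ k = 0" for k
    proof (cases "u $ k = u $ i")
      case True
      have "t' c *\<^sub>R row X0 c $ k = 0" if "c \<in> arcs G" for c
      proof (cases "c \<in> S \<and> u $ head G c \<noteq> u $ i")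
        case c: True
        then have "head G c \<noteq> k" "tail G c \<noteq> k"
          using True uS[of c] by auto
        then show ?thesis by (simp add: row_def axis_def)
      next
        case False
        then show ?thesis using S that by (auto simp: t'_def)
      qed
      then show ?thesis
        unfolding net_force_rows sum_component vector_scaleR_component by (intro sum.neutral) blast
    next
      case False
      have "t' c *\<^sub>R row X0 c $ k = t c *\<^sub>R row X0 c $ k" if "c \<in> arcs G" for c
      proof (cases "c \<in> S \<and> u $ head G c = u $ i")
        case c: True
        then have "head G c \<noteq> k" "tail G c \<noteq> k"
          using False uS[of c] by auto
        then show ?thesis by (simp add: row_def axis_def)
      next
        case False
        then show ?thesis using S that by (auto simp: t'_def)
      qed
      then have "net_force X0 t' $ k = net_force X0 t $ k"
        unfolding net_force_rows sum_component vector_scaleR_component by (rule sum.cong[OF refl])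
      also have "\<dots> = 0"
        using False uij by (auto simp: t(1) couple_def axis_def)
      finally show ?thesis .
    qed
    then have "net_force X0 t' = net_force X0 (\<lambda>_. 0)"
      by (simp add: vec_eq_iff net_force_rows)
    from stress_freeD[OF inf_rigid_stress_free[OF X0] this]
    have t'0: "t' c = 0" if "c \<in> arcs G" for c
      using that .
    have hd: "u $ head G c = u $ i" if "c \<in> S" for c
    proof (rule ccontr)
      assume "u $ head G c \<noteq> u $ i"
      then have "t' c = t c" by (simp add: t'_def)
      then show False
        using t'0[of c] that unfolding S by simp
    qed
    have ui: "u $ k = u $ i" if k: "k \<in> verts H" for k
    proof -
      consider "k = i" | "k = j" | c where "c \<in> S" "k = head G c" | c where "c \<in> S" "k = tail G c"
      proof -
        have "k \<in> {i, j} \<union> head G ` S \<union> tail G ` S"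
          using k by (simp add: H_def)
        with that show thesis by blast
      qed
      then show ?thesis
      proof cases
        case 4
        then show ?thesis using uS[of c] hd[of c] by simp
      qed (use uij hd in simp_all)
    qed
    have "u $ k = u $ l" if "k \<in> verts H" "l \<in> verts H" for k l
      using ui[OF that(1)] ui[OF that(2)] by simp
    then show "u \<in> trivial_zero_modes H"
      using u unfolding zero_modes_def trivial_zero_modes_def by blast
  qed
  moreover have "H.stress_free X0"
    by (rule stress_free_subgraph[OF H inf_rigid_stress_free[OF X0]])
  ultimately have "isostatic L1 L2 m H"
    using H.isostaticI[OF restrict_config_in] H.inf_rigid_restrict H.stress_free_restrict by metis
  then show ?thesis
    using H ne by (intro exI[of _ H]) (simp add: H_def)
qed

text \<open>Existential over configurations and forces, so that the tensions of all other edges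
  vanish identically. This is the fixed support that \<open>common_rotation_rate\<close>
  requires.\<close>

definition stressable :: "'v \<Rightarrow> 'v \<Rightarrow> 'e set" where
  "stressable i j = {c \<in> arcs G. \<exists>X\<in>configs (verts G). inf_rigid X \<and>
     (\<exists>y. response X (couple i j y) c \<noteq> 0)}"

lemma stressable_subset: "stressable i j \<subseteq> arcs G"
  by (auto simp: stressable_def)

lemma polynomial_fst: "polynomial_function (fst :: 'a::euclidean_space \<times> 'b::euclidean_space \<Rightarrow> 'a)"
  by (rule polynomial_function_bounded_linear[OF bounded_linear_fst])

lemma polynomial_snd: "polynomial_function (snd :: 'a::euclidean_space \<times> 'b::euclidean_space \<Rightarrow> 'b)"
  by (rule polynomial_function_bounded_linear[OF bounded_linear_snd])

lemma subspace_configs_UNIV: "subspace (configs U \<times> (UNIV :: (real^2) set))"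
  by (intro subspace_Times subspace_configs subspace_UNIV)

lemma generically_fst:
  assumes "generically (configs U) P"
  shows "generically (configs U \<times> (UNIV :: (real^2) set)) (\<lambda>p. P (fst p))"
  using assms polynomial_fst by (rule generically_compose) auto

lemma generically_stressable:
  assumes "c \<in> stressable i j"
  shows "generically (configs (verts G) \<times> UNIV)
    (\<lambda>p. inf_rigid (fst p) \<longrightarrow> response (fst p) (couple i j (snd p)) c \<noteq> 0)"
proof -
  obtain X y where "X \<in> configs (verts G)" "inf_rigid X" "response X (couple i j y) c \<noteq> 0"
    using assms unfolding stressable_def by blast
  then show ?thesis
    by (intro generically_response_nonzero[of fst "\<lambda>p. couple i j (snd p)" "(X, y)"]
        polynomial_fst polynomial_couple polynomial_snd) auto
qed

lemma generically_all_stressable: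
  "generically (configs (verts G) \<times> UNIV)
    (\<lambda>p. inf_rigid (fst p) \<and> snd p \<noteq> 0 \<and> (\<forall>c\<in>stressable i j. response (fst p) (couple i j (snd p)) c \<noteq> 0))"
proof -
  let ?W = "configs (verts G) \<times> (UNIV :: (real^2) set)"
  have "real_polynomial_function (\<lambda>p :: (real^2^'v) \<times> (real^2). snd p $ 1)"
    by (intro real_polynomial_function_vec_nth polynomial_snd)
  from generically_nonzero[OF this, of "(0, axis 1 1)" ?W]
  have "generically ?W (\<lambda>p. snd p $ 1 \<noteq> 0)"
    using subspace_0[OF subspace_configs[of "verts G"]] by (simp add: axis_def)
  then have "generically ?W (\<lambda>p. snd p \<noteq> 0)"
    by (rule generically_mono) auto
  moreover have "generically ?W (\<lambda>p. \<forall>c\<in>stressable i j.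
      inf_rigid (fst p) \<longrightarrow> response (fst p) (couple i j (snd p)) c \<noteq> 0)"
    using subspace_0[OF subspace_configs[of "verts G"]]
    by (intro generically_ball subspace_configs_UNIV generically_stressable)
      (auto simp: stressable_def)
  ultimately have "generically ?W (\<lambda>p. inf_rigid (fst p) \<and> snd p \<noteq> 0 \<and> (\<forall>c\<in>stressable i j.
      inf_rigid (fst p) \<longrightarrow> response (fst p) (couple i j (snd p)) c \<noteq> 0))"
    by (intro generically_conj subspace_configs_UNIV generically_fst generically_inf_rigid)
  then show ?thesis
    by (rule generically_mono) auto
qed

text \<open>At a generic \<open>X0\<close> the tensions of every force between \<open>i\<close> and
  \<open>j\<close> are supported in \<open>stressable i j\<close>. Virtual work with all these
  forces shows that a motion of this set moves \<open>i\<close> and \<open>j\<close> equally; hence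
  its common rotation rate is zero and the set is rigid.\<close>

lemma stressable_isostatic:
  assumes ij: "i \<in> verts G" "j \<in> verts G" "i \<noteq> j"
  shows "\<exists>H. subgraph H G \<and> arcs H = stressable i j \<and> arcs H \<noteq> {} \<and> isostatic L1 L2 m H"
proof -
  let ?S = "stressable i j"
  obtain X0 y0 where X0: "X0 \<in> configs (verts G)" "inf_rigid X0" "y0 \<noteq> 0"
      "\<And>c. c \<in> ?S \<Longrightarrow> response X0 (couple i j y0) c \<noteq> 0"
    using generically_ex[OF generically_all_stressable[of i j]] by auto
  have S0: "response X (couple i j y) c = 0"
    if "X \<in> configs (verts G)" "inf_rigid X" "c \<in> arcs G - ?S" for X y c
    using that by (auto simp: stressable_def)
  \<comment> \<open>The real gain for which the fictitious edge from \<open>i\<close> to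
    \<open>j\<close> has edge vector \<open>y0\<close> at \<open>X0\<close>; elsewhere it follows
    the configuration.\<close>
  define g where "g = y0 - (X0 $ j - X0 $ i)"
  have link: "link i j g X0 = y0"
    by (simp add: link_def g_def)
  show ?thesis
  proof (rule isostatic_support[OF ij X0(2)])
    show "net_force X0 (response X0 (couple i j y0)) = couple i j y0"
      using X0(2) couple_in_loads[OF ij(1,2)] by (rule net_force_response)
    show "?S = {c \<in> arcs G. response X0 (couple i j y0) c \<noteq> 0}"
      using X0(4) S0[OF X0(1,2), of _ y0] stressable_subset by blast
    fix u assume u: "\<And>c. c \<in> ?S \<Longrightarrow> strain X0 u c = 0"
    have "y \<bullet> (u $ i - u $ j) = 0" for y
    proof -
      have "(\<Sum>c\<in>arcs G. response X0 (couple i j y) c * strain X0 u c) = 0"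
        using S0[OF X0(1,2)] u by (intro sum.neutral) auto
      then show ?thesis
        using response_work[OF X0(2) ij(1,2)] by simp
    qed
    from this[of "u $ i - u $ j"] have uij: "u $ i = u $ j"
      by simp
    obtain r where r: "u $ j - u $ i = r *\<^sub>R rot (link i j g X0)"
      "\<And>c. c \<in> ?S \<Longrightarrow> u $ head G c - u $ tail G c = r *\<^sub>R rot (dvec X0 c)"
    proof (rule common_rotation_rate[where S = ?S and u = u and i = i and j = j and g = g and ?X0.0 = X0])
      show "link_response i j g X c = 0"
        if "X \<in> configs (verts G)" "inf_rigid X" "c \<in> arcs G - ?S" for X c
        unfolding link_response_def by (rule S0[OF that])
      show "?S \<subseteq> arcs G" by (rule stressable_subset)
    qed (use ij X0 u link in \<open>auto simp: link_response_def\<close>)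
    have "r = 0"
      using r(1) uij X0(3) by (simp add: link)
    then show "u $ i = u $ j \<and> (\<forall>c\<in>?S. u $ head G c = u $ tail G c)"
      using r(2) uij by simp
  qed (rule X0(3))
qed

section \<open>Conditions (c) and (d)\<close>

lemma all_stressable:
  assumes "no_proper_isostatic_subgraph L1 L2 m G"
    and ij: "i \<in> verts G" "j \<in> verts G" "i \<noteq> j"
  shows "stressable i j = arcs G"
proof -
  obtain H where "subgraph H G" "arcs H = stressable i j" "arcs H \<noteq> {}" "isostatic L1 L2 m H"
    using stressable_isostatic[OF ij] by blast
  moreover from this have "H = G"
    using assms(1) unfolding no_proper_isostatic_subgraph_def by blast
  ultimately show ?thesis by simp
qed

text \<open>Take the mode that strains only \<open>b\<close>. By reciprocity its relative motion of
  \<open>i\<close> and \<open>j\<close>, paired with a force \<open>y\<close>, is the tension of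
  \<open>b\<close> under that force pair, and some \<open>y\<close> stresses
  \<open>b\<close>.\<close>

lemma no_proper_imp_deletion_moves_all:
  assumes a: "no_proper_isostatic_subgraph L1 L2 m G"
  shows "deletion_moves_all L1 L2 m G"
  unfolding deletion_moves_all_def
proof
  fix b assume b: "b \<in> arcs G"
  let ?W = "configs (verts G)"
  let ?P = "{p \<in> verts G \<times> verts G. fst p \<noteq> snd p}"
  have "generically ?W (\<lambda>X. \<exists>y. inf_rigid X \<longrightarrow> response X (couple (fst p) (snd p) y) b \<noteq> 0)"
    if "p \<in> ?P" for p
  proof -
    have "b \<in> stressable (fst p) (snd p)"
      using all_stressable[OF a, of "fst p" "snd p"] that b by auto
    then obtain X y where X: "X \<in> ?W" "inf_rigid X" "response X (couple (fst p) (snd p) y) b \<noteq> 0"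
      unfolding stressable_def by blast
    have "generically ?W (\<lambda>X. inf_rigid X \<longrightarrow> response X (couple (fst p) (snd p) y) b \<noteq> 0)"
      by (rule generically_response_nonzero[OF polynomial_function_id[unfolded id_def]
            polynomial_function_const X])
    then show ?thesis
      by (rule generically_mono) blast
  qed
  then have "generically ?W (\<lambda>X. \<forall>p\<in>?P. \<exists>y. inf_rigid X \<longrightarrow> response X (couple (fst p) (snd p) y) b \<noteq> 0)"
    using subspace_0[OF subspace_configs[of "verts G"]]
    by (intro generically_ball subspace_configs) auto
  then have "generically ?W (\<lambda>X. inf_rigid X \<and>
      (\<forall>p\<in>?P. \<exists>y. inf_rigid X \<longrightarrow> response X (couple (fst p) (snd p) y) b \<noteq> 0))"
    by (intro generically_conj subspace_configs generically_inf_rigid)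
  then show "generically ?W (\<lambda>X. \<exists>u\<in>zero_modes L1 L2 m (del_arc b) X.
      \<forall>i\<in>verts G. \<forall>j\<in>verts G. i \<noteq> j \<longrightarrow> u $ i \<noteq> u $ j)"
  proof (rule generically_mono)
    fix X assume X: "inf_rigid X \<and>
      (\<forall>p\<in>?P. \<exists>y. inf_rigid X \<longrightarrow> response X (couple (fst p) (snd p) y) b \<noteq> 0)"
    then have rig: "inf_rigid X" by blast
    obtain u where u: "u \<in> ?W" "\<And>c. c \<in> arcs G \<Longrightarrow> strain X u c = (if c = b then 1 else 0)"
        "\<And>F. F \<in> loads (verts G) \<Longrightarrow> F \<bullet> u = response X F b"
      by (rule ex_strain_single[OF rig inf_rigid_stress_free[OF rig] b]) (rule that)
    have "u $ i \<noteq> u $ j" if ij: "i \<in> verts G" "j \<in> verts G" "i \<noteq> j" for i j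
    proof -
      have "(i, j) \<in> ?P"
        using ij by simp
      then have "\<exists>y. inf_rigid X \<longrightarrow> response X (couple (fst (i, j)) (snd (i, j)) y) b \<noteq> 0"
        using X by blast
      then obtain y where "response X (couple i j y) b \<noteq> 0"
        using rig by auto
      then have "y \<bullet> (u $ i - u $ j) \<noteq> 0"
        using u(3)[OF couple_in_loads[OF ij(1,2)], of y] by (simp add: couple_inner)
      then show ?thesis by auto
    qed
    then show "\<exists>u\<in>zero_modes L1 L2 m (del_arc b) X. \<forall>i\<in>verts G. \<forall>j\<in>verts G. i \<noteq> j \<longrightarrow> u $ i \<noteq> u $ j"
      using u(1,2) by (intro bexI[of _ u]) (auto simp: zero_modes_del_arc)
  qed
qed

lemma generically_subgraph_inf_rigid:
  assumes H: "subgraph H G" "isostatic L1 L2 m H"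
  shows "generically (configs (verts G)) (torus_graph.inf_rigid H L1 L2 m)"
proof -
  interpret H: isostatic_graph H L1 L2 m
    using torus_subgraph[OF H(1)] H(2) by (simp add: isostatic_graph_def isostatic_graph_axioms_def)
  have "verts H \<subseteq> verts G" using H(1) by blast
  from generically_restrict_config[OF H.generically_inf_rigid this] show ?thesis
    unfolding H.inf_rigid_restrict .
qed

lemma two_verts:
  assumes "card (A :: 'v set) \<ge> 2"
  obtains i j where "i \<in> A" "j \<in> A" "i \<noteq> j"
proof -
  obtain B where "B \<subseteq> A" "card B = 2"
    using assms obtain_subset_with_card_n by metis
  then show thesis
    using that by (auto simp: card_2_iff)
qed

text \<open>A motion of \<open>G - b\<close> with \<open>b\<close> outside a rigid \<open>H\<close>
  restricts to a translation of \<open>H\<close>, which has two vertices.\<close>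

lemma deletion_moves_all_imp_no_proper:
  assumes c: "deletion_moves_all L1 L2 m G"
  shows "no_proper_isostatic_subgraph L1 L2 m G"
  unfolding no_proper_isostatic_subgraph_def
proof (intro notI, elim exE conjE)
  fix H assume H: "subgraph H G" "H \<noteq> G" "arcs H \<noteq> {}" "isostatic L1 L2 m H"
  interpret H: torus_graph H L1 L2 m
    using torus_subgraph[OF H(1)] .
  note proper = proper_verts[OF H(1,4,3,2)]
  obtain b where b: "b \<in> arcs G" "b \<notin> arcs H"
    using proper(3) by blast
  obtain i j where ij: "i \<in> verts H" "j \<in> verts H" "i \<noteq> j"
    using two_verts[OF proper(2)] .
  have "generically (configs (verts G)) (\<lambda>X. H.inf_rigid X \<and>
      (\<exists>u\<in>zero_modes L1 L2 m (del_arc b) X. \<forall>i\<in>verts G. \<forall>j\<in>verts G. i \<noteq> j \<longrightarrow> u $ i \<noteq> u $ j))"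
    using c b(1) generically_subgraph_inf_rigid[OF H(1,4)] unfolding deletion_moves_all_def
    by (intro generically_conj subspace_configs) auto
  from generically_ex[OF this]
  obtain X u where X: "H.inf_rigid X" and u: "u \<in> zero_modes L1 L2 m (del_arc b) X"
      "\<forall>i\<in>verts G. \<forall>j\<in>verts G. i \<noteq> j \<longrightarrow> u $ i \<noteq> u $ j"
    by blast
  define w where "w = restrict_config (verts H) u"
  have HE: "head H = head G" "tail H = tail G"
    using H(1) by (auto simp: subgraph_def compatible_def)
  have "H.strain X w c = 0" if "c \<in> arcs H" for c
  proof -
    have "H.strain X w c = strain X u c"
      using H.head_in_verts[OF that] H.tail_in_verts[OF that]
      by (simp add: compat_def edge_vec_def HE w_def restrict_config_def)
    also have "c \<in> arcs G - {b}"
      using that b(2) proper(3) by blast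
    then have "strain X u c = 0"
      using u(1) by (simp add: zero_modes_del_arc)
    finally show ?thesis .
  qed
  then have "w \<in> zero_modes L1 L2 m H X"
    by (simp add: zero_modes_def w_def restrict_config_in)
  then have "w \<in> trivial_zero_modes H"
    using X unfolding H.inf_rigid_def by blast
  then have "w $ i = w $ j"
    using ij(1,2) unfolding trivial_zero_modes_def by blast
  then have "u $ i = u $ j"
    using ij by (simp add: w_def restrict_config_def)
  then show False
    using u(2) ij proper(1) by blast
qed

lemma balances_iff:
  "{t'. balances L1 L2 m G X t' F} = {t'. t' \<in> tensions (arcs G) \<and> net_force X t' = F}"
  by (auto simp: balances_def)

lemma unique_balance:
  assumes X: "inf_rigid X" and F: "F \<in> loads (verts G)"
  shows "{t'. balances L1 L2 m G X t' F} = {response X F}"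
proof -
  have "t' = response X F" if "t' \<in> tensions (arcs G)" "net_force X t' = F" for t'
  proof
    fix c
    show "t' c = response X F c"
    proof (cases "c \<in> arcs G")
      case True
      then show ?thesis
        using response_eqI[OF inf_rigid_stress_free[OF X] X that(2)] by simp
    qed (use that in \<open>auto simp: tensions_def response_def\<close>)
  qed
  moreover have "response X F \<in> tensions (arcs G)"
    by (simp add: tensions_def response_def)
  ultimately show ?thesis
    using net_force_response[OF X F] unfolding balances_iff by blast
qed

lemma no_proper_imp_torque_stresses_all:
  assumes a: "no_proper_isostatic_subgraph L1 L2 m G"
  shows "torque_stresses_all L1 L2 m G"
  unfolding torque_stresses_all_def
proof
  fix b assume b: "b \<in> arcs G"
  let ?i = "tail G b" and ?j = "head G b"
  have ij: "?i \<in> verts G" "?j \<in> verts G" "?i \<noteq> ?j"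
    using b no_loop by auto
  show "generically (configs (verts G) \<times> UNIV)
        (\<lambda>(X, f). \<exists>t. {t'. balances L1 L2 m G X t' (force_pair ?i ?j f)} = {t} \<and>
                      (\<forall>c\<in>arcs G. t c \<noteq> 0))"
    using generically_all_stressable[of ?i ?j]
  proof (rule generically_mono)
    fix p assume p: "inf_rigid (fst p) \<and> snd p \<noteq> 0 \<and>
        (\<forall>c\<in>stressable ?i ?j. response (fst p) (couple ?i ?j (snd p)) c \<noteq> 0)"
    then show "case p of (X, f) \<Rightarrow> \<exists>t. {t'. balances L1 L2 m G X t' (force_pair ?i ?j f)} = {t} \<and>
                      (\<forall>c\<in>arcs G. t c \<noteq> 0)"
      using unique_balance[OF _ couple_in_loads[OF ij(1,2)]]
      by (simp add: case_prod_beta couple_eq_force_pair[OF ij(3)] all_stressable[OF a ij])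
  qed
qed

text \<open>\<open>H\<close> alone can carry the force pair, and extending its tensions by zero
  gives the unique tensions of \<open>G\<close>.\<close>

lemma subgraph_response:
  assumes H: "subgraph H G" and X: "torus_graph.inf_rigid H L1 L2 m X" "inf_rigid X"
    and ij: "i \<in> verts H" "j \<in> verts H" and c: "c \<notin> arcs H"
  shows "response X (couple i j y) c = 0"
proof (cases "c \<in> arcs G")
  case True
  interpret H: torus_graph H L1 L2 m
    using torus_subgraph[OF H] .
  define t where "t b = (if b \<in> arcs H then H.response X (couple i j y) b else 0)" for b
  have "net_force X t = (\<Sum>b\<in>arcs H. H.response X (couple i j y) b *\<^sub>R row X b)"
    unfolding net_force_rows using H
    by (intro sum.mono_neutral_cong_right) (auto simp: t_def subgraph_def)
  also have "\<dots> = H.net_force X (H.response X (couple i j y))"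
    by (simp add: H.net_force_rows row_subgraph[OF H])
  also have "\<dots> = couple i j y"
    using X(1) axis_diff_in_loads[OF ij] unfolding couple_def by (rule H.net_force_response)
  finally show ?thesis
    using response_eqI[OF inf_rigid_stress_free[OF X(2)] X(2) _ True, of t "couple i j y"] c
    by (simp add: t_def)
qed (simp add: response_def)

lemma torque_stresses_all_imp_no_proper:
  assumes d: "torque_stresses_all L1 L2 m G"
  shows "no_proper_isostatic_subgraph L1 L2 m G"
  unfolding no_proper_isostatic_subgraph_def
proof (intro notI, elim exE conjE)
  fix H assume H: "subgraph H G" "H \<noteq> G" "arcs H \<noteq> {}" "isostatic L1 L2 m H"
  interpret H: torus_graph H L1 L2 m
    using torus_subgraph[OF H(1)] .
  note proper = proper_verts[OF H(1,4,3,2)]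
  obtain c where c: "c \<in> arcs G" "c \<notin> arcs H"
    using proper(3) by blast
  obtain b where b: "b \<in> arcs H"
    using H(3) by blast
  have bG: "b \<in> arcs G"
    using b proper(3) by blast
  have HE: "head H = head G" "tail H = tail G"
    using H(1) by (auto simp: subgraph_def compatible_def)
  let ?i = "tail G b" and ?j = "head G b"
  have ij: "?i \<in> verts H" "?j \<in> verts H" "?i \<noteq> ?j"
    using H.head_in_verts[OF b] H.tail_in_verts[OF b] no_loop[OF bG] by (simp_all add: HE)
  have "generically (configs (verts G) \<times> (UNIV :: (real^2) set)) (\<lambda>p.
     (inf_rigid (fst p) \<and> H.inf_rigid (fst p)) \<and>
     (case p of (X, f) \<Rightarrow> \<exists>t. {t'. balances L1 L2 m G X t' (force_pair ?i ?j f)} = {t} \<and>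
                      (\<forall>c\<in>arcs G. t c \<noteq> 0)))"
    using d bG generically_subgraph_inf_rigid[OF H(1,4)] unfolding torque_stresses_all_def
    by (intro generically_conj subspace_configs_UNIV generically_fst generically_inf_rigid) auto
  then obtain X f t where X: "inf_rigid X" "H.inf_rigid X"
      and t: "{t'. balances L1 L2 m G X t' (couple ?i ?j f)} = {t}" "\<forall>c\<in>arcs G. t c \<noteq> 0"
    unfolding couple_eq_force_pair[OF ij(3)] using generically_ex by fastforce
  have "t = response X (couple ?i ?j f)"
    using t(1) unique_balance[OF X(1) couple_in_loads] bG by auto
  then have "t c = 0"
    using subgraph_response[OF H(1) X(2,1) ij(1,2) c(2)] by simp
  with t(2) c(1) show False by blast
qed

end


section \<open>Gains and potentials\<close>

text \<open>A telescoping sum; the group is kept general because it serves both gains and plane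
  vectors.\<close>

lemma sum_along_walk:
  fixes \<phi> :: "'v \<Rightarrow> 'a::ab_group_add"
  assumes "pre_digraph.cas (bidirected G) u p v"
  shows "(\<Sum>(b, d)\<leftarrow>p. if d then \<phi> (head G b) - \<phi> (tail G b) else - (\<phi> (head G b) - \<phi> (tail G b)))
    = \<phi> v - \<phi> u"
  using assms
proof (induction p arbitrary: u)
  case Nil
  then show ?case by (simp add: pre_digraph.cas.simps)
next
  case (Cons e p)
  obtain b d where e: "e = (b, d)" by (cases e)
  have "tail (bidirected G) e = u" "pre_digraph.cas (bidirected G) (head (bidirected G) e) p v"
    using Cons.prems by (simp_all add: pre_digraph.cas.simps)
  then show ?case
    using Cons.IH[of "head (bidirected G) e"] by (cases d) (simp_all add: e bidirected_def)
qed

lemma net_gain_potential: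
  assumes cas: "pre_digraph.cas (bidirected G) u p v" and p: "fst ` set p \<subseteq> A"
    and \<phi>: "\<And>b. b \<in> A \<Longrightarrow> m b = \<phi> (head G b) - \<phi> (tail G b)"
  shows "net_gain m p = \<phi> v - \<phi> u"
proof -
  have "net_gain m p = (\<Sum>(b, d)\<leftarrow>p. if d then \<phi> (head G b) - \<phi> (tail G b)
      else - (\<phi> (head G b) - \<phi> (tail G b)))"
    unfolding net_gain_def
    by (rule arg_cong[where f = sum_list], rule map_cong[OF refl]) (use p \<phi> in force)
  then show ?thesis
    using sum_along_walk[OF cas, of \<phi>] by simp
qed

lemma wf_bidirected: "wf_digraph G \<Longrightarrow> wf_digraph (bidirected G)"
  by (auto simp: wf_digraph_def bidirected_def)

text \<open>A second use of the first edge, in either direction, would return to the starting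
  vertex, which a simple path does not revisit.\<close>

lemma apath_bidirected_distinct:
  assumes wf: "wf_digraph G" and p: "pre_digraph.apath (bidirected G) u p v"
  shows "distinct (map fst p)"
proof -
  interpret B: wf_digraph "bidirected G"
    using wf by (rule wf_bidirected)
  show ?thesis
    using p
  proof (induction p arbitrary: u)
    case (Cons e p)
    have path: "tail (bidirected G) e = u" "B.apath (head (bidirected G) e) p v"
        "u \<notin> set (B.awalk_verts (head (bidirected G) e) p)"
      using Cons.prems by (auto simp: B.apath_Cons_iff)
    have "fst e \<notin> set (map fst p)"
    proof
      assume "fst e \<in> set (map fst p)"
      then obtain f where f: "f \<in> set p" "fst f = fst e" by auto
      have "tail (bidirected G) f = u \<or> head (bidirected G) f = u"
        using path(1) f(2) by (cases e; cases f) (auto simp: bidirected_def split: if_splits)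
      moreover have "tail (bidirected G) f \<in> set (B.awalk_verts (head (bidirected G) e) p)"
        using f(1) by (rule B.awalk_verts_arc1)
      moreover have "head (bidirected G) f \<in> set (B.awalk_verts (head (bidirected G) e) p)"
        using B.awalkI_apath[OF path(2)] f(1) by (rule B.awalk_verts_arc2)
      ultimately show False
        using path(3) by auto
    qed
    then show ?case
      using Cons.IH[OF path(2)] by simp
  qed simp
qed

lemma compatible_bidirected:
  assumes "tail G = tail H" "head G = head H"
  shows "compatible (bidirected G) (bidirected H)"
  unfolding compatible_def bidirected_def assms by simp

lemma undirected_cycle_mono:
  assumes "undirected_cycle H p" "verts H \<subseteq> verts G" "arcs H \<subseteq> arcs G"
    "tail H = tail G" "head H = head G"
  shows "undirected_cycle G p"
proof -
  have comp: "compatible (bidirected G) (bidirected H)"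
    using assms(4,5) by (intro compatible_bidirected) simp_all
  have "verts (bidirected H) \<subseteq> verts (bidirected G)" "arcs (bidirected H) \<subseteq> arcs (bidirected G)"
    using assms by (auto simp: bidirected_def)
  then show ?thesis
    using assms(1)
    unfolding undirected_cycle_def pre_digraph.cycle_def pre_digraph.awalk_def
      compatible_cas[OF comp] compatible_awalk_verts[OF comp] by blast
qed

text \<open>
  The potential is built edge by edge. A new edge either closes a cycle, or joins two components, one
  of which can be shifted.
\<close>

lemma nonconstructive_potential:
  assumes "finite A" "wf_digraph \<lparr>verts = V, arcs = A, tail = t, head = h\<rparr>"
    and "\<not> constructive m \<lparr>verts = V, arcs = A, tail = t, head = h\<rparr>"
  shows "\<exists>\<phi>. \<forall>b\<in>A. m b = \<phi> (h b) - \<phi> (t b)"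
  using assms
proof (induction A rule: finite_induct)
  case (insert b A)
  let ?G = "\<lambda>A. \<lparr>verts = V, arcs = A, tail = t, head = h\<rparr>"
  let ?B = "bidirected (?G A)"
  have wf: "wf_digraph (?G A)"
    using insert.prems(1) by (auto simp: wf_digraph_def)
  have b: "t b \<in> V" "h b \<in> V"
    using insert.prems(1) by (auto simp: wf_digraph_def)
  have "\<not> constructive m (?G A)"
  proof
    assume "constructive m (?G A)"
    then obtain p where "undirected_cycle (?G A) p" "net_gain m p \<noteq> 0"
      unfolding constructive_def by blast
    moreover from this(1) have "undirected_cycle (?G (insert b A)) p"
      by (rule undirected_cycle_mono) auto
    ultimately show False
      using insert.prems(2) unfolding constructive_def by blast
  qed
  then obtain \<phi> where \<phi>: "\<And>c. c \<in> A \<Longrightarrow> m c = \<phi> (h c) - \<phi> (t c)"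
    using insert.IH[OF wf] by blast
  interpret B: wf_digraph ?B
    using wf by (rule wf_bidirected)
  define R where "R = {v. h b \<rightarrow>\<^sup>*\<^bsub>?B\<^esub> v}"
  have R: "h c \<in> R \<longleftrightarrow> t c \<in> R" if "c \<in> A" for c
  proof -
    have "t c \<rightarrow>\<^bsub>?B\<^esub> h c"
      by (rule B.dominatesI[of "(c, True)"]) (use that in \<open>auto simp: bidirected_def arc_to_ends_def\<close>)
    moreover have "h c \<rightarrow>\<^bsub>?B\<^esub> t c"
      by (rule B.dominatesI[of "(c, False)"]) (use that in \<open>auto simp: bidirected_def arc_to_ends_def\<close>)
    ultimately show ?thesis
      unfolding R_def by (auto intro: B.reachable_adj_trans)
  qed
  have "h b \<in> verts ?B"
    using b by (simp add: bidirected_def)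
  then have hR: "h b \<in> R"
    unfolding R_def by (simp only: B.reachable_refl mem_Collect_eq)
  show ?case
  proof (cases "t b \<in> R")
    case True
    then have "h b \<rightarrow>\<^sup>*\<^bsub>?B\<^esub> t b"
      by (simp only: R_def mem_Collect_eq)
    then obtain q where "B.awalk (h b) q (t b)"
      by (auto simp: B.reachable_awalk)
    then obtain p where p: "B.apath (h b) p (t b)"
      using B.apath_awalk_to_apath by blast
    then have aw: "B.awalk (h b) p (t b)" "distinct (B.awalk_verts (h b) p)"
      by (simp_all add: B.apath_def)
    have setp: "fst ` set p \<subseteq> A"
    proof -
      have "arcs ?B = A \<times> UNIV"
        by (simp add: bidirected_def)
      then have "set p \<subseteq> A \<times> UNIV"
        using aw(1) unfolding B.awalk_def by simp
      then show ?thesis by force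
    qed
    let ?B' = "bidirected (?G (insert b A))"
    have comp: "compatible ?B' ?B"
      by (rule compatible_bidirected) simp_all
    have "pre_digraph.cas ?B' (h b) p (t b)"
      using aw(1) unfolding compatible_cas[OF comp] B.awalk_def by blast
    then have cas: "pre_digraph.cas ?B' (t b) ((b, True) # p) (t b)"
      by (simp add: pre_digraph.cas.simps) (simp add: bidirected_def)
    have "tail ?B (b, True) = t b" "head ?B (b, True) = h b"
      by (simp_all add: bidirected_def)
    then have verts: "pre_digraph.awalk_verts ?B' (t b) ((b, True) # p) = t b # B.awalk_verts (h b) p"
      unfolding compatible_awalk_verts[OF comp] by simp
    have "verts ?B' = V" "arcs ?B' = insert b A \<times> UNIV"
      by (simp_all add: bidirected_def)
    moreover have "set p \<subseteq> insert b A \<times> UNIV"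
      using setp by force
    ultimately have "pre_digraph.awalk ?B' (t b) ((b, True) # p) (t b)"
      using cas b(1) by (simp add: pre_digraph.awalk_def)
    then have "pre_digraph.cycle ?B' ((b, True) # p)"
      unfolding pre_digraph.cycle_def using aw(2) verts
      by (intro exI[of _ "t b"] conjI) simp_all
    moreover have "distinct (map fst ((b, True) # p))"
      using apath_bidirected_distinct[OF wf p] setp insert.hyps(2) by auto
    ultimately have "net_gain m ((b, True) # p) = 0"
      using insert.prems(2) unfolding constructive_def undirected_cycle_def by blast
    moreover have "net_gain m p = \<phi> (t b) - \<phi> (h b)"
      using net_gain_potential[of "?G A" "h b" p "t b" A m \<phi>] aw(1) setp \<phi>
      by (simp add: B.awalk_def)
    moreover have "net_gain m ((b, True) # p) = m b + net_gain m p"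
      by (simp add: net_gain_def)
    ultimately have "m b + (\<phi> (t b) - \<phi> (h b)) = 0"
      by simp
    then have "m b = - (\<phi> (t b) - \<phi> (h b))"
      by (simp only: eq_neg_iff_add_eq_0)
    then have "m b = \<phi> (h b) - \<phi> (t b)"
      by simp
    with \<phi> show ?thesis by blast
  next
    case False
    \<comment> \<open>Shifting the component of \<open>h b\<close> by the defect of \<open>b\<close>
      repairs the equation for \<open>b\<close>. Edges of \<open>A\<close> have both ends on the
      same side of \<open>R\<close> and keep theirs.\<close>
    define \<psi> where "\<psi> v = \<phi> v + (if v \<in> R then m b - (\<phi> (h b) - \<phi> (t b)) else 0)" for v
    have "m c = \<psi> (h c) - \<psi> (t c)" if "c \<in> insert b A" for c
      using that False hR R[of c] \<phi>[of c] by (cases "c = b") (auto simp: \<psi>_def)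
    then show ?thesis by blast
  qed
qed simp

definition lattice_vec :: "real^2 \<Rightarrow> real^2 \<Rightarrow> gain \<Rightarrow> real^2" where
  "lattice_vec L1 L2 k = of_int (fst k) *\<^sub>R L1 + of_int (snd k) *\<^sub>R L2"

lemma lattice_vec_add: "lattice_vec L1 L2 (k + l) = lattice_vec L1 L2 k + lattice_vec L1 L2 l"
  by (simp add: lattice_vec_def algebra_simps)

lemma lattice_vec_minus: "lattice_vec L1 L2 (- k) = - lattice_vec L1 L2 k"
  by (simp add: lattice_vec_def)

lemma lattice_vec_diff: "lattice_vec L1 L2 (k - l) = lattice_vec L1 L2 k - lattice_vec L1 L2 l"
  by (simp add: lattice_vec_def algebra_simps)

lemma edge_vec_lattice_vec:
  "edge_vec L1 L2 m G X b = X $ head G b - X $ tail G b + lattice_vec L1 L2 (m b)"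
  by (simp add: edge_vec_def lattice_vec_def)

lemma basis_eq_0:
  assumes "L1 \<noteq> L2" "independent {L1, L2}" "a *\<^sub>R L1 + b *\<^sub>R L2 = (0 :: real^2)"
  shows "a = 0 \<and> b = 0"
  using independent_explicit_finite_subsets[of "{L1, L2}"] assms
  by (auto dest!: spec[of _ "{L1, L2}"] spec[of _ "\<lambda>v. if v = L1 then a else b"])

lemma lattice_vec_eq_0:
  assumes "L1 \<noteq> L2" "independent {L1, L2}" "lattice_vec L1 L2 k = 0"
  shows "k = 0"
  using basis_eq_0[OF assms(1,2), of "of_int (fst k)" "of_int (snd k)"] assms(3)
  by (simp add: lattice_vec_def prod_eq_iff)

lemma orthogonal_to_basis:
  fixes L1 L2 w :: "real^2"
  assumes "L1 \<noteq> L2" "independent {L1, L2}" "w \<bullet> L1 = 0" "w \<bullet> L2 = 0"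
  shows "w = 0"
proof (rule ccontr)
  assume w: "w \<noteq> 0"
  obtain a b where "L1 = a *\<^sub>R rot w" "L2 = b *\<^sub>R rot w"
    using orthogonal_imp_rot[OF w assms(3)] orthogonal_imp_rot[OF w assms(4)] by blast
  then have "b *\<^sub>R L1 + (- a) *\<^sub>R L2 = 0" by simp
  then have "a = 0" "b = 0"
    using basis_eq_0[OF assms(1,2)] by (metis add.inverse_inverse neg_0_equal_iff_equal)+
  then have "L1 = L2"
    using \<open>L1 = a *\<^sub>R rot w\<close> \<open>L2 = b *\<^sub>R rot w\<close> by simp
  with assms(1) show False ..
qed

text \<open>On the parabola of gains \<open>(n, n\<^sup>2)\<close> each linear condition is a nonzero quadratic polynomial.\<close>

lemma ex_gain_avoiding:
  fixes L1 L2 x :: "real^2"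
  assumes L: "L1 \<noteq> L2" "independent {L1, L2}" and S: "finite S" and \<tau>: "\<And>c. c \<in> S \<Longrightarrow> \<tau> c \<noteq> 0"
  shows "\<exists>k. \<forall>c\<in>S. \<tau> c \<bullet> (x + lattice_vec L1 L2 k) \<noteq> 0"
proof -
  \<comment> \<open>The condition at the gain \<open>(n, n^2)\<close> as a polynomial in
    \<open>n\<close>; it is nonzero since a nonzero \<open>\<tau> c\<close> is not orthogonal to
    both basis vectors.\<close>
  define q where "q c = [: \<tau> c \<bullet> x, \<tau> c \<bullet> L1, \<tau> c \<bullet> L2 :]" for c
  have "finite {z. poly (q c) z = 0}" if "c \<in> S" for c
  proof (rule poly_roots_finite)
    show "q c \<noteq> 0"
      using orthogonal_to_basis[OF L, of "\<tau> c"] \<tau>[OF that] by (auto simp: q_def)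
  qed
  then have fin: "finite (\<Union>c\<in>S. {z. poly (q c) z = 0})"
    using S by blast
  have "\<not> range real \<subseteq> (\<Union>c\<in>S. {z. poly (q c) z = 0})"
    using finite_subset[OF _ fin] range_inj_infinite[OF inj_of_nat] by blast
  then obtain n where n: "\<And>c. c \<in> S \<Longrightarrow> poly (q c) (real n) \<noteq> 0"
    by auto
  have "\<tau> c \<bullet> (x + lattice_vec L1 L2 (int n, int n * int n)) = poly (q c) (real n)" for c
    by (simp add: q_def lattice_vec_def inner_add_right algebra_simps)
  then show ?thesis
    using n by (intro exI[of _ "(int n, int n * int n)"]) simp
qed


section \<open>Adding an edge\<close>

locale isostatic_lattice_graph = isostatic_graph G L1 L2 m
  for G :: "('v::finite, 'e) pre_digraph" and L1 L2 m +
  assumes lattice: "L1 \<noteq> L2" "independent {L1, L2}"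
begin

lemma link_edge_vec:
  "link i j (lattice_vec L1 L2 k) X = edge_vec L1 L2 (add_gain m k) (add_edge G i j) X None"
  by (simp add: link_def edge_vec_lattice_vec add_gain_def add_edge_def)

lemma edge_vec_add_edge:
  "edge_vec L1 L2 (add_gain m k) (add_edge G i j) X (Some c) = dvec X c"
  by (simp add: edge_vec_def add_gain_def add_edge_def)

lemma torus_graph_add_edge:
  assumes "i \<in> verts G" "j \<in> verts G"
  shows "torus_graph (add_edge G i j)"
  using assms by unfold_locales (auto simp: add_edge_def)

lemma net_force_add_edge:
  assumes ij: "i \<in> verts G" "j \<in> verts G"
  shows "equilibrium L1 L2 (add_gain m k) (add_edge G i j) X s =
    net_force X (\<lambda>c. s (Some c)) - s None *\<^sub>R couple i j (link i j (lattice_vec L1 L2 k) X)"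
proof -
  interpret A: torus_graph "add_edge G i j" L1 L2 "add_gain m k"
    using ij by (rule torus_graph_add_edge)
  have "A.row X (Some c) = row X c" for c
    unfolding A.row_def row_def edge_vec_add_edge by (simp add: add_edge_def)
  moreover have "A.row X None = - couple i j (link i j (lattice_vec L1 L2 k) X)"
    unfolding A.row_def link_edge_vec[symmetric] by (simp add: add_edge_def couple_def)
  moreover have "arcs (add_edge G i j) = insert None (Some ` arcs G)"
    by (simp add: add_edge_def)
  ultimately show ?thesis
    by (simp add: A.net_force_rows net_force_rows sum.reindex)
qed

text \<open>Normalized to tension 1 on the new edge \<open>None\<close>; the tensions of
  \<open>G\<close> then balance the pull of that edge.\<close>

definition added_stress :: "'v \<Rightarrow> 'v \<Rightarrow> gain \<Rightarrow> real^2^'v \<Rightarrow> 'e option \<Rightarrow> real" where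
  "added_stress i j k X = case_option 1 (link_response i j (lattice_vec L1 L2 k) X)"

lemma self_stresses_add_edge:
  assumes ij: "i \<in> verts G" "j \<in> verts G" and X: "inf_rigid X"
  shows "self_stresses L1 L2 (add_gain m k) (add_edge G i j) X = range (\<lambda>a c. a * added_stress i j k X c)"
    (is "?L = ?R")
proof
  let ?F = "couple i j (link i j (lattice_vec L1 L2 k) X)"
  let ?t = "link_response i j (lattice_vec L1 L2 k) X"
  have t: "net_force X ?t = ?F"
    unfolding link_response_def by (rule net_force_response[OF X couple_in_loads[OF ij]])
  have scale: "net_force X (\<lambda>c. a * ?t c) = a *\<^sub>R ?F" for a
    by (simp add: t[symmetric] net_force_rows scaleR_sum_right)
  show "?L \<subseteq> ?R"
  proof
    fix s assume s: "s \<in> ?L"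
    then have "net_force X (\<lambda>c. s (Some c)) = net_force X (\<lambda>c. s None * ?t c)"
      by (simp add: self_stresses_def net_force_add_edge[OF ij] scale)
    from stress_freeD[OF inf_rigid_stress_free[OF X] this]
    have eq: "s (Some c) = s None * ?t c" if "c \<in> arcs G" for c
      using that .
    have "s = (\<lambda>c. s None * added_stress i j k X c)"
    proof
      fix c
      show "s c = s None * added_stress i j k X c"
      proof (cases c)
        case (Some b)
        then show ?thesis
          using s eq[of b] by (cases "b \<in> arcs G")
            (auto simp: added_stress_def self_stresses_def tensions_def add_edge_def link_response_def
              response_def)
      qed (simp add: added_stress_def)
    qed
    then show "s \<in> ?R" by blast
  qed
  show "?R \<subseteq> ?L"
  proof
    fix s assume "s \<in> ?R"
    then obtain a where s: "s = (\<lambda>c. a * added_stress i j k X c)" by blast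
    have "s \<in> tensions (arcs (add_edge G i j))"
      by (auto simp: s tensions_def add_edge_def added_stress_def link_response_def response_def
          split: option.split)
    moreover have "equilibrium L1 L2 (add_gain m k) (add_edge G i j) X s = 0"
      by (simp add: net_force_add_edge[OF ij] s added_stress_def scale)
    ultimately show "s \<in> ?L"
      by (simp add: self_stresses_def)
  qed
qed

text \<open>Subtracting the rotation \<open>r *\<^sub>R rot (X $ v)\<close> from \<open>u\<close>
  leaves differences that depend only on the gains. Around the cycle they add up to zero, but also
  to \<open>r\<close> times the rotated lattice vector of the nonzero net gain.\<close>

lemma lattice_cycle_rotation:
  assumes cyc: "undirected_cycle H p" "net_gain m' p \<noteq> 0"
    and u: "\<And>b. b \<in> arcs H \<Longrightarrow> u $ head H b - u $ tail H b = r *\<^sub>R rot (edge_vec L1 L2 m' H X b)"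
  shows "r = 0"
proof -
  obtain w where w: "pre_digraph.awalk (bidirected H) w p w"
    using cyc(1) unfolding undirected_cycle_def pre_digraph.cycle_def by blast
  then have cas: "pre_digraph.cas (bidirected H) w p w" and p: "fst ` set p \<subseteq> arcs H"
    by (auto simp: pre_digraph.awalk_def bidirected_def)
  define \<phi> where "\<phi> v = u $ v - r *\<^sub>R rot (X $ v)" for v
  have \<phi>: "\<phi> (head H b) - \<phi> (tail H b) = r *\<^sub>R rot (lattice_vec L1 L2 (m' b))" if "b \<in> arcs H" for b
    using u[OF that] by (simp add: \<phi>_def edge_vec_lattice_vec rot_add rot_diff algebra_simps)
  have "(\<Sum>(b, d)\<leftarrow>p. if d then r *\<^sub>R rot (lattice_vec L1 L2 (m' b))
      else - (r *\<^sub>R rot (lattice_vec L1 L2 (m' b)))) = r *\<^sub>R rot (lattice_vec L1 L2 (net_gain m' p))"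
    for p
  proof (induction p)
    case Nil
    show ?case by (simp add: net_gain_def lattice_vec_def rot_def vec_eq_iff)
  next
    case (Cons e p)
    have "rot (- x) = - rot x" for x
      by (simp add: vec_eq_iff forall_2)
    then show ?case
      using Cons by (cases e) (auto simp: net_gain_def lattice_vec_add lattice_vec_minus rot_add
          scaleR_add_right)
  qed
  moreover have "(\<Sum>(b, d)\<leftarrow>p. if d then r *\<^sub>R rot (lattice_vec L1 L2 (m' b))
      else - (r *\<^sub>R rot (lattice_vec L1 L2 (m' b)))) =
      (\<Sum>(b, d)\<leftarrow>p. if d then \<phi> (head H b) - \<phi> (tail H b) else - (\<phi> (head H b) - \<phi> (tail H b)))"
  proof (rule arg_cong[where f = sum_list], rule map_cong[OF refl])
    fix e assume "e \<in> set p"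
    moreover obtain b d where e: "e = (b, d)" by (cases e)
    ultimately have "b \<in> arcs H"
      using p by force
    then show "(case e of (b, d) \<Rightarrow> if d then r *\<^sub>R rot (lattice_vec L1 L2 (m' b))
        else - (r *\<^sub>R rot (lattice_vec L1 L2 (m' b)))) =
      (case e of (b, d) \<Rightarrow> if d then \<phi> (head H b) - \<phi> (tail H b) else - (\<phi> (head H b) - \<phi> (tail H b)))"
      by (simp only: e \<phi> case_prod_conv)
  qed
  ultimately have "r *\<^sub>R rot (lattice_vec L1 L2 (net_gain m' p)) = 0"
    using sum_along_walk[OF cas, of \<phi>] by simp
  then show ?thesis
    using lattice_vec_eq_0[OF lattice, of "net_gain m' p"] cyc(2)
    by (metis rot_eq_0_iff scaleR_eq_0_iff)
qed

lemma link_nonzero_generic: "i \<noteq> j \<Longrightarrow> j \<in> verts G \<Longrightarrow>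
  generically (configs (verts G)) (\<lambda>X. link i j g X \<noteq> 0)"
proof -
  assume ij: "i \<noteq> j" "j \<in> verts G"
  have "real_polynomial_function (\<lambda>X. link i j g X $ 1)"
    using polynomial_link by (rule real_polynomial_function_vec_nth)
  \<comment> \<open>At this configuration the link is the first unit vector.\<close>
  from generically_nonzero[OF this, of "axis j (axis 1 1 - g)" "configs (verts G)"]
  have "generically (configs (verts G)) (\<lambda>X. link i j g X $ 1 \<noteq> 0)"
    using ij by (auto simp: configs_def link_def axis_def)
  then show ?thesis
    by (rule generically_mono) auto
qed

lemma generically_link_response:
  assumes "X \<in> configs (verts G)" "inf_rigid X" "link_response i j g X c \<noteq> 0"
  shows "generically (configs (verts G)) (\<lambda>X. inf_rigid X \<longrightarrow> link_response i j g X c \<noteq> 0)"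
  using generically_response_nonzero[OF polynomial_function_id[unfolded id_def]
      polynomial_couple[OF polynomial_link] assms(1,2)] assms(3)
  unfolding link_response_def by blast

text \<open>The alternative is decided once for all configurations, by the set \<open>S\<close> of
  edges stressed somewhere: together with the new edge it forms \<open>H\<close>.\<close>

lemma no_proper_imp_added_edge_stress:
  assumes a: "no_proper_isostatic_subgraph L1 L2 m G"
  shows "added_edge_stress L1 L2 m G"
  unfolding added_edge_stress_def Let_def
proof (intro ballI allI impI)
  fix i j k assume ij: "i \<in> verts G" "j \<in> verts G" "i \<noteq> j"
  let ?G = "add_edge G i j" and ?m = "add_gain m k" and ?g = "lattice_vec L1 L2 k"
  let ?W = "configs (verts G)"
  define S where "S = {c \<in> arcs G. \<exists>X\<in>?W. inf_rigid X \<and> link_response i j ?g X c \<noteq> 0}"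
  have SG: "S \<subseteq> arcs G" by (auto simp: S_def)
  then have finS: "finite S"
    by (rule finite_subset) (rule finite_arcs)
  have S0: "link_response i j ?g X c = 0" if "X \<in> ?W" "inf_rigid X" "c \<in> arcs G - S" for X c
    using that by (auto simp: S_def)
  have "generically ?W (\<lambda>X. inf_rigid X \<longrightarrow> link_response i j ?g X c \<noteq> 0)" if "c \<in> S" for c
    using that generically_link_response unfolding S_def by blast
  then have "generically ?W (\<lambda>X. \<forall>c\<in>S. inf_rigid X \<longrightarrow> link_response i j ?g X c \<noteq> 0)"
    using subspace_0[OF subspace_configs[of "verts G"]] finS
    by (intro generically_ball subspace_configs) auto
  then have "generically ?W (\<lambda>X. inf_rigid X \<and> link i j ?g X \<noteq> 0 \<and>
      (\<forall>c\<in>S. inf_rigid X \<longrightarrow> link_response i j ?g X c \<noteq> 0))"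
    using ij by (intro generically_conj subspace_configs generically_inf_rigid link_nonzero_generic)
  then have gen: "generically ?W (\<lambda>X. inf_rigid X \<and> link i j ?g X \<noteq> 0 \<and>
      (\<forall>c\<in>S. link_response i j ?g X c \<noteq> 0))"
    by (rule generically_mono) blast
  define H where "H = \<lparr>verts = verts G, arcs = insert None (Some ` S), tail = tail ?G, head = head ?G\<rparr>"
  have H: "subgraph H ?G"
  proof (rule subgraphI)
    show "wf_digraph H"
      using ij SG by unfold_locales (auto simp: H_def add_edge_def)
    show "wf_digraph ?G"
      using torus_graph_add_edge[OF ij(1,2)] by (simp add: torus_graph_def fin_digraph_def)
  qed (use SG in \<open>auto simp: H_def add_edge_def compatible_def\<close>)
  \<comment> \<open>A cycle of \<open>H\<close> with nonzero net gain forces the common rotation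
    rate to be zero; then \<open>S\<close> carries an isostatic subgraph, which must be
    \<open>G\<close>.\<close>
  have alt: "S = arcs G \<or> \<not> constructive ?m H"
  proof (rule ccontr)
    assume "\<not> ?thesis"
    then have "S \<noteq> arcs G" and con: "constructive ?m H"
      by auto
    then obtain p where p: "undirected_cycle H p" "net_gain ?m p \<noteq> 0"
      unfolding constructive_def by blast
    obtain X0 where X0: "X0 \<in> ?W" "inf_rigid X0" "link i j ?g X0 \<noteq> 0"
        "\<And>c. c \<in> S \<Longrightarrow> link_response i j ?g X0 c \<noteq> 0"
      using generically_ex[OF gen] by blast
    have "\<exists>K. subgraph K G \<and> arcs K = S \<and> arcs K \<noteq> {} \<and> isostatic L1 L2 m K"
    proof (rule isostatic_support[OF ij X0(2)])
      show "net_force X0 (link_response i j ?g X0) = couple i j (link i j ?g X0)"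
        unfolding link_response_def by (rule net_force_response[OF X0(2) couple_in_loads[OF ij(1,2)]])
      show "S = {c \<in> arcs G. link_response i j ?g X0 c \<noteq> 0}"
        using X0(4) S0[OF X0(1,2)] SG by blast
      fix u assume u: "\<And>c. c \<in> S \<Longrightarrow> strain X0 u c = 0"
      obtain r where r: "u $ j - u $ i = r *\<^sub>R rot (link i j ?g X0)"
        "\<And>c. c \<in> S \<Longrightarrow> u $ head G c - u $ tail G c = r *\<^sub>R rot (dvec X0 c)"
        using common_rotation_rate[OF ij(1,2) X0(1-3) S0 SG X0(4) u] by metis
      have ev: "edge_vec L1 L2 ?m H X0 = edge_vec L1 L2 ?m ?G X0"
        by (simp add: edge_vec_def[abs_def] H_def)
      have "u $ head H b - u $ tail H b = r *\<^sub>R rot (edge_vec L1 L2 ?m H X0 b)" if "b \<in> arcs H" for b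
      proof (cases b)
        case None
        have "head H b = j" "tail H b = i"
          by (simp_all add: None H_def add_edge_def)
        then show ?thesis
          using r(1) unfolding ev by (simp add: None link_edge_vec)
      next
        case (Some c)
        have "head H b = head G c" "tail H b = tail G c" "c \<in> S"
          using that by (auto simp: Some H_def add_edge_def)
        then show ?thesis
          using r(2)[of c] unfolding ev by (simp add: Some edge_vec_add_edge)
      qed
      then have "r = 0"
        by (rule lattice_cycle_rotation[OF p])
      then show "u $ i = u $ j \<and> (\<forall>c\<in>S. u $ head G c = u $ tail G c)"
        using r by simp
    qed (rule X0(3))
    then show False
      using a \<open>S \<noteq> arcs G\<close> unfolding no_proper_isostatic_subgraph_def by blast
  qed
  show "generically ?W (\<lambda>X. \<exists>s. s \<noteq> (\<lambda>_. 0) \<and>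
      self_stresses L1 L2 ?m ?G X = range (\<lambda>a c. a * s c) \<and>
      ((\<forall>c\<in>arcs ?G. s c \<noteq> 0) \<or>
       (\<exists>H. subgraph H ?G \<and> \<not> constructive ?m H \<and> (\<forall>c\<in>arcs ?G. s c \<noteq> 0 \<longrightarrow> c \<in> arcs H))))"
    using gen
  proof (rule generically_mono)
    fix X assume W: "X \<in> ?W" and X: "inf_rigid X \<and> link i j ?g X \<noteq> 0 \<and>
      (\<forall>c\<in>S. link_response i j ?g X c \<noteq> 0)"
    let ?s = "added_stress i j k X"
    have "?s None \<noteq> 0" by (simp add: added_stress_def)
    then have "?s \<noteq> (\<lambda>_. 0)" by auto
    moreover have "self_stresses L1 L2 ?m ?G X = range (\<lambda>a c. a * ?s c)"
      using X by (intro self_stresses_add_edge[OF ij(1,2)]) blast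
    moreover have "(\<forall>c\<in>arcs ?G. ?s c \<noteq> 0) \<or>
       (\<exists>H. subgraph H ?G \<and> \<not> constructive ?m H \<and> (\<forall>c\<in>arcs ?G. ?s c \<noteq> 0 \<longrightarrow> c \<in> arcs H))"
      using alt
    proof
      assume "S = arcs G"
      then show ?thesis
        using X by (auto simp: add_edge_def added_stress_def)
    next
      assume "\<not> constructive ?m H"
      moreover have "c \<in> arcs H" if "c \<in> arcs ?G" "?s c \<noteq> 0" for c
      proof (cases c)
        case (Some b)
        have "b \<in> S"
        proof (rule ccontr)
          assume "b \<notin> S"
          then have "link_response i j ?g X b = 0"
            using that(1) X by (intro S0[OF W]) (auto simp: Some add_edge_def)
          then show False
            using that(2) by (simp add: Some added_stress_def)
        qed
        then show ?thesis by (simp add: Some H_def)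
      qed (simp add: H_def)
      ultimately show ?thesis
        using H by blast
    qed
    ultimately show "\<exists>s. s \<noteq> (\<lambda>_. 0) \<and> self_stresses L1 L2 ?m ?G X = range (\<lambda>a c. a * s c) \<and>
      ((\<forall>c\<in>arcs ?G. s c \<noteq> 0) \<or>
       (\<exists>H. subgraph H ?G \<and> \<not> constructive ?m H \<and> (\<forall>c\<in>arcs ?G. s c \<noteq> 0 \<longrightarrow> c \<in> arcs H)))"
      by blast
  qed
qed

text \<open>With \<open>i\<close> and \<open>j\<close> in a proper \<open>H\<close>, forces between
  them stress only edges of \<open>H\<close>, so the first alternative fails. A gain that stresses
  all of \<open>stressable i j\<close> refutes the second: a non-constructive support could rotate
  in the plane, yet it resists every force between \<open>i\<close> and \<open>j\<close>.\<close>

lemma added_edge_stress_imp_no_proper: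
  assumes e: "added_edge_stress L1 L2 m G"
  shows "no_proper_isostatic_subgraph L1 L2 m G"
  unfolding no_proper_isostatic_subgraph_def
proof (intro notI, elim exE conjE)
  fix H assume H: "subgraph H G" "H \<noteq> G" "arcs H \<noteq> {}" "isostatic L1 L2 m H"
  interpret H: torus_graph H L1 L2 m
    using torus_subgraph[OF H(1)] .
  note proper = proper_verts[OF H(1,4,3,2)]
  let ?W = "configs (verts G)"
  obtain i j where ijH: "i \<in> verts H" "j \<in> verts H" "i \<noteq> j"
    using two_verts[OF proper(2)] .
  then have ij: "i \<in> verts G" "j \<in> verts G" "i \<noteq> j"
    using proper(1) by auto
  let ?S = "stressable i j"
  have SG: "c \<in> arcs G" if "c \<in> ?S" for c
    using that stressable_subset by blast
  have "?S \<subseteq> arcs H"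
  proof
    fix c assume "c \<in> ?S"
    then have "generically (?W \<times> (UNIV :: (real^2) set)) (\<lambda>p. inf_rigid (fst p) \<and> H.inf_rigid (fst p) \<and>
        (inf_rigid (fst p) \<longrightarrow> response (fst p) (couple i j (snd p)) c \<noteq> 0))"
      by (intro generically_conj subspace_configs_UNIV generically_fst generically_inf_rigid
          generically_stressable generically_subgraph_inf_rigid[OF H(1,4)])
    from generically_ex[OF this] show "c \<in> arcs H"
      using subgraph_response[OF H(1) _ _ ijH(1,2)] by blast
  qed
  then obtain c0 where c0: "c0 \<in> arcs G" "c0 \<notin> ?S"
    using proper(3) by blast
  obtain X0 y0 where X0: "X0 \<in> ?W" "inf_rigid X0"
      "\<And>c. c \<in> ?S \<Longrightarrow> response X0 (couple i j y0) c \<noteq> 0"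
    using generically_ex[OF generically_all_stressable[of i j]] by auto
  \<comment> \<open>By reciprocity each tension is linear in the force, so that the bad gains
    satisfy linear conditions.\<close>
  have "\<exists>\<tau>. \<forall>y. response X0 (couple i j y) c = \<tau> \<bullet> y" if c: "c \<in> arcs G" for c
  proof -
    obtain u where "\<And>F. F \<in> loads (verts G) \<Longrightarrow> F \<bullet> u = response X0 F c"
      by (rule ex_strain_single[OF X0(2) inf_rigid_stress_free[OF X0(2)] c]) (rule that)
    then have "response X0 (couple i j y) c = (u $ i - u $ j) \<bullet> y" for y
      using couple_in_loads[OF ij(1,2), of y] by (metis couple_inner inner_commute)
    then show ?thesis by blast
  qed
  then obtain \<tau> where \<tau>: "\<And>c y. c \<in> arcs G \<Longrightarrow> response X0 (couple i j y) c = \<tau> c \<bullet> y"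
    by metis
  have "\<tau> c \<noteq> 0" if "c \<in> ?S" for c
    using X0(3)[OF that] \<tau>[OF SG[OF that], of y0] by auto
  then obtain k where k: "\<And>c. c \<in> ?S \<Longrightarrow> \<tau> c \<bullet> ((X0 $ j - X0 $ i) + lattice_vec L1 L2 k) \<noteq> 0"
    using ex_gain_avoiding[OF lattice finite_subset[OF stressable_subset finite_arcs]] by metis
  let ?G = "add_edge G i j" and ?m = "add_gain m k" and ?g = "lattice_vec L1 L2 k"
  have "link_response i j ?g X0 c \<noteq> 0" if "c \<in> ?S" for c
    using k[OF that] \<tau>[OF SG[OF that], of "link i j ?g X0"]
    by (simp add: link_response_def link_def algebra_simps)
  then have "generically ?W (\<lambda>X. inf_rigid X \<longrightarrow> link_response i j ?g X c \<noteq> 0)" if "c \<in> ?S" for c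
    using that by (intro generically_link_response[OF X0(1,2)])
  then have "generically ?W (\<lambda>X. \<forall>c\<in>?S. inf_rigid X \<longrightarrow> link_response i j ?g X c \<noteq> 0)"
    using subspace_0[OF subspace_configs[of "verts G"]]
    by (intro generically_ball subspace_configs finite_subset[OF stressable_subset finite_arcs]) auto
  moreover have "generically ?W (\<lambda>X. \<exists>s. s \<noteq> (\<lambda>_. 0) \<and>
      self_stresses L1 L2 ?m ?G X = range (\<lambda>a c. a * s c) \<and>
      ((\<forall>c\<in>arcs ?G. s c \<noteq> 0) \<or>
       (\<exists>H. subgraph H ?G \<and> \<not> constructive ?m H \<and> (\<forall>c\<in>arcs ?G. s c \<noteq> 0 \<longrightarrow> c \<in> arcs H))))"
    using e ij unfolding added_edge_stress_def Let_def by blast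
  ultimately have "generically ?W (\<lambda>X. inf_rigid X \<and> link i j ?g X \<noteq> 0 \<and>
      (\<forall>c\<in>?S. inf_rigid X \<longrightarrow> link_response i j ?g X c \<noteq> 0) \<and>
      (\<exists>s. s \<noteq> (\<lambda>_. 0) \<and> self_stresses L1 L2 ?m ?G X = range (\<lambda>a c. a * s c) \<and>
      ((\<forall>c\<in>arcs ?G. s c \<noteq> 0) \<or>
       (\<exists>H. subgraph H ?G \<and> \<not> constructive ?m H \<and> (\<forall>c\<in>arcs ?G. s c \<noteq> 0 \<longrightarrow> c \<in> arcs H)))))"
    using ij by (intro generically_conj subspace_configs generically_inf_rigid link_nonzero_generic)
  from generically_ex[OF this]
  obtain X s where X: "X \<in> ?W" "inf_rigid X" "link i j ?g X \<noteq> 0"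
      "\<And>c. c \<in> ?S \<Longrightarrow> link_response i j ?g X c \<noteq> 0"
    and s: "self_stresses L1 L2 ?m ?G X = range (\<lambda>a c. a * s c)"
      "(\<forall>c\<in>arcs ?G. s c \<noteq> 0) \<or>
       (\<exists>H. subgraph H ?G \<and> \<not> constructive ?m H \<and> (\<forall>c\<in>arcs ?G. s c \<noteq> 0 \<longrightarrow> c \<in> arcs H))"
    by blast
  \<comment> \<open>The given \<open>s\<close> and \<open>added_stress\<close> span the same line,
    so \<open>a\<close> is nonzero and they vanish on the same edges.\<close>
  have "added_stress i j k X \<in> range (\<lambda>a c. a * added_stress i j k X c)"
    by (rule range_eqI[of _ _ 1]) simp
  then obtain a where a: "added_stress i j k X = (\<lambda>c. a * s c)"
    using s(1) self_stresses_add_edge[OF ij(1,2) X(2)] by blast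
  have zero: "response X (couple i j y) c = 0" if "c \<in> arcs G - ?S" for c y
    using that X(1,2) by (auto simp: stressable_def)
  have aN: "a * s None = 1"
    using fun_cong[OF a, of None] by (simp add: added_stress_def)
  have aS: "a * s (Some c) = link_response i j ?g X c" for c
    using fun_cong[OF a, of "Some c"] by (simp add: added_stress_def)
  have "s (Some c0) = 0"
    using aS[of c0] aN zero[of c0] c0 by (auto simp: link_response_def)
  then obtain K where K: "subgraph K ?G" "\<not> constructive ?m K"
      "\<And>c. c \<in> arcs ?G \<Longrightarrow> s c \<noteq> 0 \<Longrightarrow> c \<in> arcs K"
    using s(2) c0(1) by (auto simp: add_edge_def)
  have KN: "None \<in> arcs K"
  proof (rule K(3))
    show "s None \<noteq> 0" using aN by auto
  qed (simp add: add_edge_def)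
  have KS: "Some c \<in> arcs K" if "c \<in> ?S" for c
  proof (rule K(3))
    show "s (Some c) \<noteq> 0" using aS[of c] X(4)[OF that] by auto
  qed (use SG[OF that] in \<open>simp add: add_edge_def\<close>)
  have KE: "K = \<lparr>verts = verts K, arcs = arcs K, tail = tail ?G, head = head ?G\<rparr>" "wf_digraph K"
    using K(1) by (auto simp: subgraph_def compatible_def)
  have "finite (arcs K)"
    using K(1) torus_graph_add_edge[OF ij(1,2)]
    by (meson fin_digraph.finite_arcs finite_subset subgraph_def torus_graph.axioms)
  then obtain \<phi> where \<phi>: "\<And>b. b \<in> arcs K \<Longrightarrow> ?m b = \<phi> (head ?G b) - \<phi> (tail ?G b)"
    using nonconstructive_potential[of "arcs K" "verts K" "tail ?G" "head ?G" ?m] KE K(2) by metis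
  \<comment> \<open>The potential unrolls \<open>K\<close> into the plane: after shifting vertex
    \<open>v\<close> by the lattice vector of \<open>\<phi> v\<close>, edge vectors are plain
    differences, and \<open>u\<close> is the infinitesimal rotation of this picture.\<close>
  define u where "u = (\<chi> v. rot (X $ v + lattice_vec L1 L2 (\<phi> v)))"
  have "strain X u c = 0" if "c \<in> ?S" for c
  proof -
    have "m c = \<phi> (head G c) - \<phi> (tail G c)"
      using \<phi>[OF KS[OF that]] by (simp add: add_gain_def add_edge_def)
    then have "u $ head G c - u $ tail G c = rot (dvec X c)"
      by (simp add: u_def edge_vec_lattice_vec lattice_vec_diff rot_add rot_diff)
    then show ?thesis
      by (simp add: compat_def inner_rot_self)
  qed
  then have "(\<Sum>c\<in>arcs G. response X (couple i j y) c * strain X u c) = 0" for y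
    using zero by (intro sum.neutral) auto
  then have "y \<bullet> (u $ i - u $ j) = 0" for y
    using response_work[OF X(2) ij(1,2)] by simp
  from this[of "u $ i - u $ j"] have "u $ i = u $ j"
    by simp
  moreover have "k = \<phi> j - \<phi> i"
    using \<phi>[OF KN] by (simp add: add_gain_def add_edge_def)
  then have "u $ j - u $ i = rot (link i j ?g X)"
    by (simp add: u_def link_def lattice_vec_diff rot_add rot_diff)
  ultimately show False
    using X(3) by simp
qed

end

theorem theorem1:
  fixes L1 L2 :: "real^2"
    and G :: "('v::finite, 'e) pre_digraph"
    and m :: "'e \<Rightarrow> int \<times> int"
  assumes lattice: "L1 \<noteq> L2" "independent {L1, L2}"
    and graph: "fin_digraph G" "loopfree_digraph G"
    and isostatic: "isostatic L1 L2 m G"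
  shows "(no_proper_isostatic_subgraph L1 L2 m G \<longleftrightarrow> orientations_strongly_connected G) \<and>
         (no_proper_isostatic_subgraph L1 L2 m G \<longleftrightarrow> deletion_moves_all L1 L2 m G) \<and>
         (no_proper_isostatic_subgraph L1 L2 m G \<longleftrightarrow> torque_stresses_all L1 L2 m G) \<and>
         (no_proper_isostatic_subgraph L1 L2 m G \<longleftrightarrow> added_edge_stress L1 L2 m G)"
proof -
  interpret isostatic_lattice_graph G L1 L2 m
    using assms by (simp add: isostatic_lattice_graph_def isostatic_lattice_graph_axioms_def
        isostatic_graph_def isostatic_graph_axioms_def torus_graph_def)
  show ?thesis
    using strongly_connected_orientations_iff
      no_proper_imp_deletion_moves_all deletion_moves_all_imp_no_proper
      no_proper_imp_torque_stresses_all torque_stresses_all_imp_no_proper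
      no_proper_imp_added_edge_stress added_edge_stress_imp_no_proper by blast
qed

end
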